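(* Let $m,n,\lambda$ be positive integers with $mn\geq 4$. Then the $\lambda$-fold line graph $\lambda L(K_{m,n})$ has a $C_4$-decomposition if and only if all of the following four conditions hold: (1) $2\mid \lambda(m+n-2)$; (2) $8\mid \lambda mn(m+n-2)$; (3) if $m\equiv 3 \pmod 8$ and $n\equiv 7\pmod 8$, or $n\equiv 3\pmod 8$ and $m\equiv 7\pmod 8$, then $\lambda\equiv 0\pmod 2$; (4) if $m=2$ and $n\equiv 1\pmod 2$, then $n\geq 5$ and $\lambda\equiv 0\pmod 8$; and if $n=2$ and $m\equiv 1\pmod 2$, then $m\geq 5$ and $\lambda\equiv 0\pmod 8$.
   Context: $K_{m,n}$ is the complete bipartite graph with parts of sizes $m$ and $n$. The line graph $L(G)$ of a simple graph $G$ has vertex set $E(G)$, with two edges $e_1,e_2$ of $G$ adjacent in $L(G)$ if and only if $|e_1\cap e_2|=1$. (Thus $L(K_{m,n})$ is isomorphic to the Cartesian product $K_m\Box K_n$.) For a simple graph $G$ and a positive integer $\lambda$, $\lambda G$ is the loopless multigraph on $V(G)$ in which $u$ and $v$ are joined by exactly $\lambda$ (distinct) edges if they are adjacent in $G$, and by no edge otherwise. The $\lambda$-fold line graph of $G$ is $\lambda L(G)$. A multigraph has a $C_4$-decomposition if its edge set can be partitioned into the edge sets of subgraphs each of which is a cycle on $4$ distinct vertices; parallel edges count as different edges. *)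

theory Defs
  imports Main "HOL-Library.Disjoint_Sets" "HOL-Number_Theory.Cong"
begin

section \<open>Simple graphs\<close>

record 'a sgraph =
  verts :: "'a set"
  edges :: "'a set set"

definition simple_graph :: "'a sgraph \<Rightarrow> bool" where
  "simple_graph G \<longleftrightarrow> (\<forall>e\<in>edges G. e \<subseteq> verts G \<and> card e = 2)"

definition complete_bipartite :: "nat \<Rightarrow> nat \<Rightarrow> (nat + nat) sgraph" where
  "complete_bipartite m n =
     \<lparr> verts = {..<m} <+> {..<n},
       edges = {{Inl i, Inr j} | i j. i < m \<and> j < n} \<rparr>"

text \<open>In a simple graph \<open>card (e \<inter> f) = 1\<close> already forces \<open>e \<noteq> f\<close>.\<close>

definition line_graph :: "'a sgraph \<Rightarrow> 'a set sgraph" where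
  "line_graph G =
     \<lparr> verts = edges G,
       edges = {{e, f} | e f. e \<in> edges G \<and> f \<in> edges G \<and> card (e \<inter> f) = 1} \<rparr>"

lemma simple_graph_complete_bipartite: "simple_graph (complete_bipartite m n)"
  by (auto simp: simple_graph_def complete_bipartite_def)

lemma simple_graph_line_graph:
  assumes "simple_graph G"
  shows "simple_graph (line_graph G)"
proof -
  have "card {e, f} = 2" if "e \<in> edges G" "card (e \<inter> f) = 1" for e f
  proof -
    have "e \<noteq> f" using that assms by (auto simp: simple_graph_def)
    then show ?thesis by simp
  qed
  then show ?thesis by (auto simp: simple_graph_def line_graph_def)
qed


section \<open>Loopless multigraphs\<close>

text \<open>Edges have an identity of their own, and \<open>mends\<close> gives the set of the two end vertices
  of an edge; parallel edges are distinct edges with the same ends. The values of \<open>mends\<close>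
  outside \<open>medges\<close> are irrelevant.\<close>

record ('v, 'e) mgraph =
  mverts :: "'v set"
  medges :: "'e set"
  mends :: "'e \<Rightarrow> 'v set"

definition multigraph :: "('v, 'e) mgraph \<Rightarrow> bool" where
  "multigraph M \<longleftrightarrow> (\<forall>e\<in>medges M. mends M e \<subseteq> mverts M \<and> card (mends M e) = 2)"

definition submultigraph :: "('v, 'e) mgraph \<Rightarrow> ('v, 'e) mgraph \<Rightarrow> bool" where
  "submultigraph H M \<longleftrightarrow> multigraph H \<and> mverts H \<subseteq> mverts M \<and> medges H \<subseteq> medges M \<and>
     (\<forall>e\<in>medges H. mends H e = mends M e)"

definition lambda_fold :: "nat \<Rightarrow> 'a sgraph \<Rightarrow> ('a, 'a set \<times> nat) mgraph" where
  "lambda_fold k G =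
     \<lparr> mverts = verts G, medges = edges G \<times> {..<k}, mends = fst \<rparr>"

lemma multigraph_lambda_fold: "simple_graph G \<Longrightarrow> multigraph (lambda_fold k G)"
  by (auto simp: simple_graph_def multigraph_def lambda_fold_def)

definition is_C4 :: "('v, 'e) mgraph \<Rightarrow> bool" where
  "is_C4 H \<longleftrightarrow> (\<exists>v0 v1 v2 v3 e0 e1 e2 e3.
     distinct [v0, v1, v2, v3] \<and>
     mverts H = {v0, v1, v2, v3} \<and> medges H = {e0, e1, e2, e3} \<and>
     mends H e0 = {v0, v1} \<and> mends H e1 = {v1, v2} \<and>
     mends H e2 = {v2, v3} \<and> mends H e3 = {v3, v0})"

definition has_C4_decomposition :: "('v, 'e) mgraph \<Rightarrow> bool" where
  "has_C4_decomposition M \<longleftrightarrow>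
     (\<exists>P. partition_on (medges M) P \<and>
          (\<forall>C\<in>P. \<exists>H. submultigraph H M \<and> is_C4 H \<and> medges H = C))"

end

(*
  Only three kinds of 4-cycles live in the Cartesian product of two complete graphs: those inside a
  row, those inside a column, and rectangles using two edges of each kind. Hence the number of
  row edges is even, which yields condition (3); for m = 2, comparing twice the number of edges in
  the first row with the number of column edges modulo 8 yields condition (4). Conversely, for every
  residue class of (m, n) only the least admissible multiplicity matters. Since K_{a+b} splits
  into K_a, K_b and K_{a,b}, and the latter decomposes for even a, b (with multiplicity 2,
      for even b
  and a > 1), everything reduces by induction to a few explicit decompositions. The delicate case is
  m = n = 5 modulo 8 with multiplicity 1, where neither the rows nor the columns decompose by
  themselves; there a step from m to m + 8 shares an old vertex in each column so as to use K_9.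
*)

theory Submission
  imports Defs "HOL-Library.Multiset" "HOL-Library.Product_Lexorder"
begin

section \<open>Decompositions of edge multisets into 4-cycles\<close>

text \<open>Copies of an edge stay anonymous as long as possible: decomposability is a property of
  edge multisets, so gluing is \<open>+\<close> and the \<open>k\<close>-fold graph is
  \<open>repeat_mset k\<close>. Edge identities return only when copies are numbered for the
  multigraph. The obstacles are the graphs K_2, K_3 and the stars K_{1,b}, which contain no 4-cycle
  at any multiplicity. Sides of length 2 or 3 therefore need rectangles, and gluing must avoid a
  part with one vertex. For multiplicity 1 the bipartite piece needs two even parts, but the old
  side is odd. Lending one old vertex to the eight new ones leaves an even old part and completes
  K_8, whose degrees are odd, to K_9. If \<open>m\<close> and \<open>n\<close> are 5 modulo 8, a row
  has 2 modulo 4 edges, so every row must meet rectangles, and so must every column. The bowtie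
  construction meets this demand: its rectangles use up 1-factors in the first five columns, chosen
  so that the rest of each K_9 still splits into 4-cycles.\<close>

inductive C4_decomposable :: "'v set multiset \<Rightarrow> bool" where
  empty: "C4_decomposable {#}"
| add: "C4_decomposable M \<Longrightarrow> distinct [a, b, c, d] \<Longrightarrow>
    C4_decomposable (M + {#{a, b}, {b, c}, {c, d}, {d, a}#})"

lemma C4_decomposable_add:
  assumes "C4_decomposable M" "C4_decomposable N"
  shows "C4_decomposable (M + N)"
  using assms(2)
proof induction
  case empty
  then show ?case using assms(1) by simp
next
  case (add N a b c d)
  from C4_decomposable.add[OF add.IH add.hyps(2)] show ?case by (simp only: add.assoc)
qed

lemma C4_decomposable_sum:
  "(\<And>i. i \<in> I \<Longrightarrow> C4_decomposable (F i)) \<Longrightarrow> C4_decomposable (\<Sum>i\<in>I. F i)"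
  by (induction I rule: infinite_finite_induct)
    (auto intro: C4_decomposable.empty C4_decomposable_add)

lemma C4_decomposable_repeat:
  "C4_decomposable M \<Longrightarrow> C4_decomposable (repeat_mset k M)"
  by (induction k) (auto intro: C4_decomposable.empty C4_decomposable_add)

lemma C4_decomposable_image:
  assumes "C4_decomposable M" "inj_on f (\<Union>(set_mset M))"
  shows "C4_decomposable (image_mset ((`) f) M)"
  using assms
proof induction
  case empty
  show ?case by (simp add: C4_decomposable.empty)
next
  case (add M a b c d)
  have inj: "inj_on f {a, b, c, d}" "inj_on f (\<Union>(set_mset M))"
    using add.prems by (auto intro: inj_on_subset)
  have "distinct [f a, f b, f c, f d]"
    using inj(1) add.hyps(2) by (auto simp: inj_on_def)
  from C4_decomposable.add[OF add.IH[OF inj(2)] this] show ?case by simp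
qed

section \<open>Decompositions with a prescribed edge multiplicity\<close>

definition fold_decomposable :: "nat \<Rightarrow> 'v set multiset \<Rightarrow> bool" where
  "fold_decomposable k M \<longleftrightarrow> C4_decomposable (repeat_mset k M)"

lemma fold_decomposable_empty [simp]: "fold_decomposable k {#}"
  by (simp add: fold_decomposable_def C4_decomposable.empty)

lemma fold_decomposable_add:
  "fold_decomposable k M \<Longrightarrow> fold_decomposable k N \<Longrightarrow> fold_decomposable k (M + N)"
  by (simp add: fold_decomposable_def C4_decomposable_add)

lemma fold_decomposable_1: "fold_decomposable 1 M \<longleftrightarrow> C4_decomposable M"
  by (simp add: fold_decomposable_def)

lemma repeat_mset_sum: "repeat_mset k (\<Sum>i\<in>I. F i) = (\<Sum>i\<in>I. repeat_mset k (F i))"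
  by (induction I rule: infinite_finite_induct) auto

lemma fold_decomposable_sum:
  "(\<And>i. i \<in> I \<Longrightarrow> fold_decomposable k (F i)) \<Longrightarrow> fold_decomposable k (\<Sum>i\<in>I. F i)"
  by (simp add: fold_decomposable_def repeat_mset_sum C4_decomposable_sum)

lemma fold_decomposable_dvd:
  assumes "fold_decomposable k M" "k dvd l"
  shows "fold_decomposable l M"
proof -
  from assms(2) obtain c where "l = c * k" by (metis dvdE mult.commute)
  then have "repeat_mset l M = repeat_mset c (repeat_mset k M)" by simp
  then show ?thesis using assms(1) by (simp only: fold_decomposable_def C4_decomposable_repeat)
qed

lemma image_mset_repeat: "image_mset f (repeat_mset k M) = repeat_mset k (image_mset f M)"
  by (induction k) auto

lemma fold_decomposable_image:
  assumes "fold_decomposable k M" "inj_on f (\<Union>(set_mset M))"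
  shows "fold_decomposable k (image_mset ((`) f) M)"
proof -
  have "set_mset (repeat_mset k M) \<subseteq> set_mset M"
    by (induction k) auto
  then have "inj_on f (\<Union>(set_mset (repeat_mset k M)))"
    using assms(2) by (blast intro: inj_on_subset)
  from C4_decomposable_image[OF _ this] show ?thesis
    using assms(1) by (simp add: fold_decomposable_def image_mset_repeat)
qed

section \<open>Lists of cycles as certificates checked by evaluation\<close>

definition edges_of :: "('v \<times> 'v) list \<Rightarrow> 'v set multiset" where
  "edges_of L = image_mset (\<lambda>(u, v). {u, v}) (mset L)"

definition orient :: "'v::linorder \<times> 'v \<Rightarrow> 'v \<times> 'v" where
  "orient = (\<lambda>(u, v). if u \<le> v then (u, v) else (v, u))"

definition cycle_edges :: "'v \<times> 'v \<times> 'v \<times> 'v \<Rightarrow> ('v \<times> 'v) list" where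
  "cycle_edges = (\<lambda>(a, b, c, d). [(a, b), (b, c), (c, d), (d, a)])"

text \<open>Sorting oriented pairs turns an equality of multisets of unordered edges into an
  equation of lists that \<open>code_simp\<close> can evaluate. Replicating each entry in place
  keeps the right-hand side sorted.\<close>

definition is_decomposition :: "nat \<Rightarrow> ('v::linorder \<times> 'v) list \<Rightarrow>
    ('v \<times> 'v \<times> 'v \<times> 'v) list \<Rightarrow> bool" where
  "is_decomposition k L cs \<longleftrightarrow> list_all (\<lambda>(a, b, c, d). distinct [a, b, c, d]) cs \<and>
     sort (map orient (concat (map cycle_edges cs))) =
     concat (map (replicate k) (sort (map orient L)))"

lemma edges_of_append [simp]: "edges_of (xs @ ys) = edges_of xs + edges_of ys"
  by (simp add: edges_of_def)

lemma edges_of_orient: "edges_of (map orient L) = edges_of L"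
  by (induction L) (auto simp: edges_of_def orient_def split: if_splits)

lemma edges_of_sort: "edges_of (sort L) = edges_of L"
  by (simp add: edges_of_def)

lemma edges_of_replicate: "edges_of (concat (map (replicate k) L)) = repeat_mset k (edges_of L)"
  by (induction L) (auto simp: edges_of_def)

lemma C4_decomposable_cycles:
  assumes "list_all (\<lambda>(a, b, c, d). distinct [a, b, c, d]) cs"
  shows "C4_decomposable (edges_of (concat (map cycle_edges cs)))"
  using assms
proof (induction cs)
  case Nil
  show ?case by (simp add: edges_of_def C4_decomposable.empty)
next
  case (Cons q cs)
  obtain a b c d where q: "q = (a, b, c, d)" by (cases q)
  have "C4_decomposable (edges_of (concat (map cycle_edges cs)) + {#{a, b}, {b, c}, {c, d}, {d,
      a}#})"
    using Cons by (intro C4_decomposable.add) (auto simp: q)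
  then show ?case by (simp add: q cycle_edges_def edges_of_def)
qed

lemma fold_decomposable_list:
  assumes "is_decomposition k L cs"
  shows "fold_decomposable k (edges_of L)"
proof -
  have "edges_of (concat (map cycle_edges cs)) = repeat_mset k (edges_of L)"
    using assms unfolding is_decomposition_def
    by (metis edges_of_orient edges_of_sort edges_of_replicate)
  then show ?thesis
    using C4_decomposable_cycles assms unfolding is_decomposition_def fold_decomposable_def
    by metis
qed

definition complete_list :: "nat \<Rightarrow> (nat \<times> nat) list" where
  "complete_list n = [(a, b). b \<leftarrow> [0..<n], a \<leftarrow> [0..<b]]"

definition grid_list :: "nat \<Rightarrow> nat \<Rightarrow> ((nat \<times> nat) \<times> (nat \<times> nat)) list" where
  "grid_list m n = [((i, a), (i, b)). i \<leftarrow> [0..<m], (a, b) \<leftarrow> complete_list n]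
     @ [((a, j), (b, j)). j \<leftarrow> [0..<n], (a, b) \<leftarrow> complete_list m]"

section \<open>Complete and complete bipartite graphs\<close>

definition complete_edges :: "'v set \<Rightarrow> 'v set set" where
  "complete_edges A = {{a, b} | a b. a \<in> A \<and> b \<in> A \<and> a \<noteq> b}"

definition bipartite_edges :: "'v set \<Rightarrow> 'v set \<Rightarrow> 'v set set" where
  "bipartite_edges A B = {{a, b} | a b. a \<in> A \<and> b \<in> B}"

abbreviation complete :: "'v set \<Rightarrow> 'v set multiset" where
  "complete A \<equiv> mset_set (complete_edges A)"

abbreviation bipartite :: "'v set \<Rightarrow> 'v set \<Rightarrow> 'v set multiset" where
  "bipartite A B \<equiv> mset_set (bipartite_edges A B)"

lemma complete_edges_eq: "complete_edges A = {e. e \<subseteq> A \<and> card e = 2}"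
  by (auto simp: complete_edges_def card_2_iff)

lemma finite_complete_edges [simp]: "finite A \<Longrightarrow> finite (complete_edges A)"
  by (simp add: complete_edges_eq)

lemma finite_bipartite_edges [simp]:
  assumes "finite A" "finite B"
  shows "finite (bipartite_edges A B)"
proof -
  have "bipartite_edges A B = (\<lambda>(a, b). {a, b}) ` (A \<times> B)"
    by (auto simp: bipartite_edges_def)
  then show ?thesis using assms by simp
qed

lemma complete_union:
  assumes "finite A" "finite B" "A \<inter> B = {}"
  shows "complete (A \<union> B) = complete A + complete B + bipartite A B"
proof -
  have "bipartite_edges A B \<subseteq> complete_edges (A \<union> B)"
    using assms(3) unfolding complete_edges_def bipartite_edges_def by blast
  then have "complete_edges A \<union> complete_edges B \<union> bipartite_edges A B \<subseteq> complete_edges (A \<union> B)"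
    by (intro Un_least) (auto simp: complete_edges_def)
  moreover have "complete_edges (A \<union> B) \<subseteq> complete_edges A \<union> complete_edges B \<union> bipartite_edges A B"
    by (auto simp: complete_edges_def bipartite_edges_def)
  ultimately have "complete_edges (A \<union> B) = complete_edges A \<union> complete_edges B \<union>
      bipartite_edges A B"
    by (rule equalityI[rotated])
  moreover have "complete_edges A \<inter> complete_edges B = {}"
    "(complete_edges A \<union> complete_edges B) \<inter> bipartite_edges A B = {}"
    using assms(3) by (auto simp: complete_edges_def bipartite_edges_def doubleton_eq_iff)
  ultimately show ?thesis using assms by (simp add: mset_set_Union)
qed

lemma bipartite_union:
  assumes "finite A" "finite A'" "finite B" "A \<inter> A' = {}" "(A \<union> A') \<inter> B = {}"
  shows "bipartite (A \<union> A') B = bipartite A B + bipartite A' B"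
proof -
  have "bipartite_edges (A \<union> A') B = bipartite_edges A B \<union> bipartite_edges A' B"
    by (auto simp: bipartite_edges_def)
  moreover have "bipartite_edges A B \<inter> bipartite_edges A' B = {}"
    using assms(4,5) by (auto simp: bipartite_edges_def doubleton_eq_iff)
  ultimately show ?thesis using assms by (simp add: mset_set_Union)
qed

lemma bipartite_commute: "bipartite A B = bipartite B A"
proof -
  have "bipartite_edges A B = bipartite_edges B A"
    unfolding bipartite_edges_def by (metis insert_commute)
  then show ?thesis by simp
qed

lemma bipartite_empty [simp]: "bipartite {} B = {#}"
  by (simp add: bipartite_edges_def)

lemma complete_image:
  assumes "inj_on f A"
  shows "complete (f ` A) = image_mset ((`) f) (complete A)"
proof -
  have "complete_edges (f ` A) = (`) f ` complete_edges A"
  proof (intro equalityI subsetI)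
    fix e assume "e \<in> complete_edges (f ` A)"
    then obtain x y where "x \<in> A" "y \<in> A" "x \<noteq> y" "e = f ` {x, y}"
      by (auto simp: complete_edges_def)
    then show "e \<in> (`) f ` complete_edges A"
      unfolding complete_edges_def by blast
  next
    fix e assume "e \<in> (`) f ` complete_edges A"
    then obtain x y where "x \<in> A" "y \<in> A" "x \<noteq> y" "e = {f x, f y}"
      by (auto simp: complete_edges_def)
    moreover from this have "f x \<noteq> f y" using assms by (auto dest: inj_onD)
    ultimately show "e \<in> complete_edges (f ` A)"
      unfolding complete_edges_def by blast
  qed
  moreover have "inj_on ((`) f) (complete_edges A)"
    by (rule inj_on_subset[OF inj_on_image_Pow[OF assms]]) (auto simp: complete_edges_def)
  ultimately show ?thesis by (simp add: image_mset_mset_set)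
qed

lemma Union_complete: "finite A \<Longrightarrow> \<Union>(set_mset (complete A)) \<subseteq> A"
  by (simp only: finite_set_mset_mset_set finite_complete_edges) (auto simp: complete_edges_def)

lemma fold_decomposable_complete_image:
  assumes "fold_decomposable k (complete A)" "inj_on f A" "finite A"
  shows "fold_decomposable k (complete (f ` A))"
  unfolding complete_image[OF assms(2)]
  by (rule fold_decomposable_image[OF assms(1) inj_on_subset[OF assms(2) Union_complete[OF
      assms(3)]]])

lemma fold_decomposable_complete_card:
  assumes "fold_decomposable k (complete {..<n})" "finite A" "card A = n"
  shows "fold_decomposable k (complete A)"
proof -
  obtain f where "bij_betw f {..<n} A"
    using assms(2,3) finite_same_card_bij[of "{..<n}" A] by auto
  then show ?thesis
    using fold_decomposable_complete_image[OF assms(1), of f] by (auto simp: bij_betw_def)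
qed

lemma bipartite_doubletons:
  assumes "distinct [a, a', b, b']"
  shows "bipartite {a, a'} {b, b'} = {#{a, b}, {b, a'}, {a', b'}, {b', a}#}"
proof -
  have "bipartite_edges {a, a'} {b, b'} = {{a, b}, {b, a'}, {a', b'}, {b', a}}"
    by (auto simp: bipartite_edges_def)
  moreover have "{a', b'} \<noteq> {b', a}" "{b, a'} \<noteq> {b', a}" "{b, a'} \<noteq> {a', b'}"
    "{a, b} \<noteq> {b', a}" "{a, b} \<noteq> {a', b'}" "{a, b} \<noteq> {b, a'}"
    using assms by (auto simp: doubleton_eq_iff)
  ultimately show ?thesis by (simp only: mset_set.insert finite.intros insert_iff empty_iff
      simp_thms mset_set.empty)
qed

lemma C4_decomposable_cycle:
  "distinct [a, b, c, d] \<Longrightarrow> C4_decomposable {#{a, b}, {b, c}, {c, d}, {d, a}#}"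
  using C4_decomposable.add[OF C4_decomposable.empty, of a b c d] by simp

lemma even_set_induct [consumes 2, case_names empty insert2]:
  assumes "finite A" "even (card A)" "P {}"
    and step: "\<And>a b A. finite A \<Longrightarrow> even (card A) \<Longrightarrow> a \<noteq> b \<Longrightarrow> a \<notin> A \<Longrightarrow> b \<notin> A \<Longrightarrow> P A \<Longrightarrow>
      P ({a, b} \<union> A)"
  shows "P A"
  using assms(1,2)
proof (induction A rule: measure_induct_rule[of card])
  case (less A)
  show ?case
  proof (cases "A = {}")
    case True
    then show ?thesis using assms(3) by simp
  next
    case False
    then obtain a where a: "a \<in> A" by blast
    have "A \<noteq> {a}" using less.prems(2) by auto
    then obtain b where b: "b \<in> A" "b \<noteq> a" using a by blast
    let ?B = "A - {a, b}"
    have A: "A = {a, b} \<union> ?B" using a b by blast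
    have "card ({a, b} \<union> ?B) = card {a, b} + card ?B"
      using less.prems by (intro card_Un_disjoint) auto
    then have card: "card A = card ?B + 2" using A b by simp
    have "P ({a, b} \<union> ?B)"
      using less.prems card b by (intro step less.IH) auto
    then show ?thesis using A by simp
  qed
qed

text \<open>Pairing off both parts cuts the graph into copies of K_{2,2}, each of which is a
  4-cycle.\<close>

lemma fold_decomposable_1_bipartite:
  assumes "finite A" "even (card A)" "finite B" "even (card B)" "A \<inter> B = {}"
  shows "fold_decomposable 1 (bipartite A B)"
  using assms
proof (induction A rule: even_set_induct)
  case empty
  show ?case by simp
next
  case (insert2 a a' A)
  have "fold_decomposable 1 (bipartite {a, a'} B)"
    using insert2.prems insert2.hyps
  proof (induction B rule: even_set_induct)
    case empty
    show ?case by (simp add: bipartite_commute[of _ "{}"])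
  next
    case (insert2 b b' B)
    have "bipartite ({b, b'} \<union> B) {a, a'} = bipartite {b, b'} {a, a'} + bipartite B {a, a'}"
      using insert2 by (intro bipartite_union) auto
    moreover have "fold_decomposable 1 (bipartite {a, a'} {b, b'})"
    proof -
      have d: "distinct [a, a', b, b']" and d': "distinct [a, b, a', b']"
        using insert2.prems insert2.hyps by auto
      show ?thesis
        unfolding bipartite_doubletons[OF d] fold_decomposable_1
        by (rule C4_decomposable_cycle[OF d'])
    qed
    ultimately show ?case
      using insert2 by (simp add: bipartite_commute[of "{a, a'}"] fold_decomposable_add)
  qed
  moreover have "bipartite ({a, a'} \<union> A) B = bipartite {a, a'} B + bipartite A B"
    using insert2 by (intro bipartite_union) auto
  ultimately show ?case using insert2 by (simp add: fold_decomposable_add)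
qed

text \<open>Each of the three pairs of points of \<open>A\<close> forms a 4-cycle with
  \<open>{b, b'}\<close>, and every point lies in two of the three pairs, which gives multiplicity
  2.\<close>

lemma fold_decomposable_2_bipartite_3:
  assumes "card A = 3" "finite B" "even (card B)" "A \<inter> B = {}"
  shows "fold_decomposable 2 (bipartite A B)"
  using assms(2,3,4)
proof (induction B rule: even_set_induct)
  case empty
  show ?case by (simp add: bipartite_commute[of _ "{}"])
next
  case (insert2 b b' B)
  obtain x y z where A: "A = {x, y, z}" "x \<noteq> y" "x \<noteq> z" "y \<noteq> z"
    using assms(1) by (auto simp: card_3_iff)
  have single: "bipartite {x, y, z} {b, b'} = bipartite {x} {b, b'} + bipartite {y} {b, b'} +
      bipartite {z} {b, b'}"
    using bipartite_union[of "{x, y}" "{z}" "{b, b'}"] bipartite_union[of "{x}" "{y}" "{b,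
        b'}"] A insert2
    by (simp add: insert_commute)
  have pair: "bipartite {u, v} {b, b'} = bipartite {u} {b, b'} + bipartite {v} {b, b'}"
    if "u \<in> A" "v \<in> A" "u \<noteq> v" for u v
    using bipartite_union[of "{u}" "{v}" "{b, b'}"] that insert2.prems
    by (auto simp: insert_commute)
  have "C4_decomposable (bipartite {u, v} {b, b'})" if "u \<in> A" "v \<in> A" "u \<noteq> v" for u v
    using fold_decomposable_1_bipartite[of "{u, v}" "{b, b'}"] that insert2.prems insert2.hyps
    by (auto simp: fold_decomposable_def)
  then have "C4_decomposable (bipartite {x, y} {b, b'} + bipartite {y, z} {b, b'} + bipartite {z,
      x} {b, b'})"
    using A by (auto intro!: C4_decomposable_add)
  then have "fold_decomposable 2 (bipartite A {b, b'})"
    using A by (simp add: pair single fold_decomposable_def numeral_2_eq_2 ac_simps)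
  moreover have "bipartite ({b, b'} \<union> B) A = bipartite {b, b'} A + bipartite B A"
    using insert2 A by (intro bipartite_union) auto
  ultimately show ?case
    using insert2 by (simp add: bipartite_commute[of A] fold_decomposable_add)
qed

text \<open>An odd part is cut into three points and an even rest. A part with one point would give
  a star, which has no 4-cycle at any multiplicity.\<close>

lemma fold_decomposable_2_bipartite:
  assumes "finite A" "card A \<ge> 2" "finite B" "even (card B)" "A \<inter> B = {}"
  shows "fold_decomposable 2 (bipartite A B)"
proof (cases "even (card A)")
  case True
  then show ?thesis
    using assms fold_decomposable_1_bipartite fold_decomposable_dvd one_dvd by blast
next
  case False
  then have "card A \<ge> 3" using assms(2) by (cases "card A = 2") auto
  then obtain A' where A': "A' \<subseteq> A" "card A' = 3"
    using obtain_subset_with_card_n by metis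
  define A'' where "A'' = A - A'"
  have fin: "finite A'" "finite A''" using A' assms(1) by (auto simp: A''_def intro: finite_subset)
  have "card A = 3 + card A''"
    using A' assms(1) by (metis A''_def add.commute card_Diff_subset card_mono fin(1)
        le_add_diff_inverse2)
  then have "even (card A'')" using False by simp
  then have "fold_decomposable 1 (bipartite A'' B)"
    using assms fin by (intro fold_decomposable_1_bipartite) (auto simp: A''_def)
  then have "fold_decomposable 2 (bipartite A'' B)"
    using fold_decomposable_dvd one_dvd by blast
  moreover have "fold_decomposable 2 (bipartite A' B)"
    using assms A' by (intro fold_decomposable_2_bipartite_3) auto
  moreover have "bipartite (A' \<union> A'') B = bipartite A' B + bipartite A'' B"
    using assms fin A' by (intro bipartite_union) (auto simp: A''_def)
  moreover have "A' \<union> A'' = A" using A' by (auto simp: A''_def)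
  ultimately show ?thesis by (simp add: fold_decomposable_add)
qed

section \<open>Products of two complete graphs\<close>

text \<open>A sum of multisets, so that rows and columns can be split and regrouped by plain
  algebra; \<open>grid_eq_mset_set\<close> later identifies it with an edge set.\<close>

definition grid :: "'a set \<Rightarrow> 'b set \<Rightarrow> ('a \<times> 'b) set multiset" where
  "grid A B = (\<Sum>i\<in>A. image_mset ((`) (Pair i)) (complete B)) +
    (\<Sum>j\<in>B. image_mset ((`) (\<lambda>i. (i, j))) (complete A))"

lemma image_mset_sum: "image_mset f (\<Sum>i\<in>I. F i) = (\<Sum>i\<in>I. image_mset f (F i))"
  by (induction I rule: infinite_finite_induct) auto

lemma grid_map_prod:
  assumes "inj_on f A" "inj_on g B"
  shows "grid (f ` A) (g ` B) = image_mset ((`) (map_prod f g)) (grid A B)"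
  using assms
  by (simp add: grid_def complete_image image_mset_sum sum.reindex multiset.map_comp comp_def
      image_image)

lemma grid_swap: "grid B A = image_mset ((`) prod.swap) (grid A B)"
  by (simp add: grid_def image_mset_sum multiset.map_comp comp_def image_image add.commute)

lemma Union_set_mset_sum:
  assumes "\<And>i. i \<in> I \<Longrightarrow> \<Union>(set_mset (F i)) \<subseteq> X"
  shows "\<Union>(set_mset (\<Sum>i\<in>I. F i)) \<subseteq> X"
  using assms by (induction I rule: infinite_finite_induct) auto

lemma Union_grid:
  assumes "finite A" "finite B"
  shows "\<Union>(set_mset (grid A B)) \<subseteq> A \<times> B"
proof -
  have "\<Union>(set_mset (\<Sum>i\<in>A. image_mset ((`) (Pair i)) (complete B))) \<subseteq> A \<times> B"
    using Union_complete[OF assms(2)] by (intro Union_set_mset_sum) fastforce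
  moreover have "\<Union>(set_mset (\<Sum>j\<in>B. image_mset ((`) (\<lambda>i. (i, j))) (complete A))) \<subseteq> A \<times> B"
    using Union_complete[OF assms(1)] by (intro Union_set_mset_sum) fastforce
  ultimately show ?thesis by (simp add: grid_def)
qed

lemma fold_decomposable_inj_image:
  "fold_decomposable k M \<Longrightarrow> inj f \<Longrightarrow> fold_decomposable k (image_mset ((`) f) M)"
  by (rule fold_decomposable_image) (auto intro: inj_on_subset)

lemma fold_decomposable_grid_swap:
  "fold_decomposable k (grid A B) \<Longrightarrow> fold_decomposable k (grid B A)"
  by (subst grid_swap) (rule fold_decomposable_inj_image, simp_all add: inj_swap)

lemma fold_decomposable_grid_image:
  assumes "fold_decomposable k (grid A B)" "inj_on f A" "inj_on g B" "finite A" "finite B"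
  shows "fold_decomposable k (grid (f ` A) (g ` B))"
proof -
  have "inj_on (map_prod f g) (\<Union>(set_mset (grid A B)))"
    using inj_on_subset[OF map_prod_inj_on[OF assms(2,3)] Union_grid[OF assms(4,5)]] .
  then show ?thesis
    using fold_decomposable_image[OF assms(1)] by (simp add: grid_map_prod[OF assms(2,3)])
qed

lemma grid_union:
  assumes "finite A" "finite A'" "A \<inter> A' = {}"
  shows "grid (A \<union> A') B = grid A B + grid A' B +
    (\<Sum>j\<in>B. image_mset ((`) (\<lambda>i. (i, j))) (bipartite A A'))"
  using assms by (simp add: grid_def complete_union sum.union_disjoint sum.distrib)

lemma edges_of_map: "edges_of (map (map_prod f f) L) = image_mset ((`) f) (edges_of L)"
  by (induction L) (auto simp: edges_of_def)

lemma bipartite_singleton: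
  assumes "finite A" "b \<notin> A"
  shows "bipartite A {b} = image_mset (\<lambda>a. {a, b}) (mset_set A)"
proof -
  have "bipartite_edges A {b} = (\<lambda>a. {a, b}) ` A" by (auto simp: bipartite_edges_def)
  moreover have "inj_on (\<lambda>a. {a, b}) A" using assms by (auto simp: inj_on_def doubleton_eq_iff)
  ultimately show ?thesis by (simp add: image_mset_mset_set)
qed

lemma edges_of_complete_list: "edges_of (complete_list n) = complete {..<n}"
proof (induction n)
  case 0
  show ?case by (simp add: complete_list_def edges_of_def complete_edges_def)
next
  case (Suc n)
  have "complete_list (Suc n) = complete_list n @ map (\<lambda>a. (a, n)) [0..<n]"
    by (simp add: complete_list_def)
  moreover have "complete {..<Suc n} = complete {..<n} + bipartite {..<n} {n}"
    using complete_union[of "{..<n}" "{n}"] by (simp add: lessThan_Suc complete_edges_def)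
  ultimately show ?case
    using Suc by (simp add: bipartite_singleton edges_of_def multiset.map_comp comp_def
        atLeast0LessThan del: upt_Suc)
qed

lemma edges_of_map_list:
  "edges_of (concat (map (\<lambda>i. map (map_prod (f i) (f i)) L) [0..<m]))
    = (\<Sum>i<m. image_mset ((`) (f i)) (edges_of L))"
  by (induction m) (simp_all add: edges_of_map, simp add: edges_of_def)

lemma edges_of_grid_list: "edges_of (grid_list m n) = grid {..<m} {..<n}"
proof -
  have "grid_list m n = concat (map (\<lambda>i. map (map_prod (Pair i) (Pair i)) (complete_list n))
      [0..<m])
     @ concat (map (\<lambda>j. map (map_prod (\<lambda>i. (i, j)) (\<lambda>i. (i, j))) (complete_list m)) [0..<n])"
    by (simp add: grid_list_def map_prod_def case_prod_unfold)
  then show ?thesis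
    by (simp only: edges_of_append edges_of_map_list edges_of_complete_list grid_def)
qed

section \<open>Explicit decompositions\<close>

text \<open>One cycle is developed modulo 9; its edges have the differences 1, 2, 3 and 4, each
  once.\<close>

lemma decomposition_K9: "is_decomposition 1 (complete_list 9)
    [(x, (x + 1) mod 9, (x + 8) mod 9, (x + 5) mod 9). x \<leftarrow> [0..<9]]"
  by code_simp

text \<open>These are all the 4-cycles of K_4; every edge is missed by exactly one of them.\<close>

lemma decomposition_2K4: "is_decomposition 2 (complete_list 4)
    [(0, 1, 2, 3), (0, 1, 3, 2), (0, 2, 1, 3)]"
  by code_simp

text \<open>There is one cycle for each omitted vertex.\<close>

definition cycles_2K5 :: "(nat \<times> nat \<times> nat \<times> nat) list" where
  "cycles_2K5 = [(0, 1, 3, 2), (0, 1, 2, 4), (0, 2, 4, 3), (0, 3, 1, 4), (1, 2, 3, 4)]"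

lemma decomposition_2K5: "is_decomposition 2 (complete_list 5) cycles_2K5"
  by code_simp

text \<open>Vertex 5 is a fixed point and the others are the residues modulo 5. The three starter
  cycles together contain four edges at the fixed point, four of difference 1 and four of difference
  2.\<close>

lemma decomposition_4K6: "is_decomposition 4 (complete_list 6)
    (concat [[(5, x, (x + 1) mod 5, (x + 2) mod 5), (5, x, (x + 2) mod 5, (x + 4) mod 5),
      (x, (x + 1) mod 5, (x + 3) mod 5, (x + 2) mod 5)]. x \<leftarrow> [0..<5]])"
  by code_simp

text \<open>Parallelograms with sides \<open>a\<close> and \<open>b\<close> use each of the two
  differences twice. Each of 1, 2, 3 occurs in two of the three pairs, hence four times.\<close>

lemma decomposition_4K7: "is_decomposition 4 (complete_list 7)
    [(x, (x + a) mod 7, (x + a + b) mod 7, (x + b) mod 7).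
      (a, b) \<leftarrow> [(1, 2), (2, 3), (3, 1)], x \<leftarrow> [0..<7]]"
  by code_simp

text \<open>All nine copies of K_{2,2} are taken; an edge extends to one in 2 times 2 ways.\<close>

lemma decomposition_4K33: "is_decomposition 4 [(a, b). a \<leftarrow> [0..<3], b \<leftarrow> [3..<6]]
    [(a, c + 3, b, d + 3). (a, b) \<leftarrow> complete_list 3, (c, d) \<leftarrow> complete_list 3]"
  by code_simp

definition rectangles :: "(nat \<times> nat) list \<Rightarrow> (nat \<times> nat) list \<Rightarrow>
    ((nat \<times> nat) \<times> (nat \<times> nat) \<times> (nat \<times> nat) \<times> (nat \<times> nat)) list" where
  "rectangles I J = [((i, a), (i, b), (j, b), (j, a)). (i, j) \<leftarrow> I, (a, b) \<leftarrow> J]"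

definition row_cycles :: "nat list \<Rightarrow> (nat \<times> nat \<times> nat \<times> nat) list \<Rightarrow>
    ((nat \<times> nat) \<times> (nat \<times> nat) \<times> (nat \<times> nat) \<times> (nat \<times> nat)) list" where
  "row_cycles I cs = [((i, a), (i, b), (i, c), (i, d)). i \<leftarrow> I, (a, b, c, d) \<leftarrow> cs]"

definition column_cycles :: "nat list \<Rightarrow> (nat \<times> nat \<times> nat \<times> nat) list \<Rightarrow>
    ((nat \<times> nat) \<times> (nat \<times> nat) \<times> (nat \<times> nat) \<times> (nat \<times> nat)) list" where
  "column_cycles J cs = [((a, j), (b, j), (c, j), (d, j)). j \<leftarrow> J, (a, b, c, d) \<leftarrow> cs]"

text \<open>All nine rectangles are taken; an edge extends to one by choosing one of two other
  parallel lines.\<close>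

lemma decomposition_2_grid_3_3: "is_decomposition 2 (grid_list 3 3)
    (rectangles (complete_list 3) (complete_list 3))"
  by code_simp

text \<open>The three row pairs take the three 4-cycles of \<open>2K\<^sub>4\<close>; each row keeps the one it misses.\<close>

lemma decomposition_2_grid_3_4: "is_decomposition 2 (grid_list 3 4)
    (rectangles [(0, 1)] [(0, 1), (1, 2), (2, 3), (0, 3)] @
     rectangles [(0, 2)] [(0, 1), (1, 3), (2, 3), (0, 2)] @
     rectangles [(1, 2)] [(0, 2), (1, 2), (1, 3), (0, 3)] @
     row_cycles [0] [(0, 2, 1, 3)] @ row_cycles [1] [(0, 1, 3, 2)] @ row_cycles [2] [(0, 1, 2, 3)])"
  by code_simp

text \<open>The family of all rectangles covers a column edge four times but a row edge only twice;
  one copy of 2K_5 per row makes up the difference.\<close>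

lemma decomposition_4_grid_3_5: "is_decomposition 4 (grid_list 3 5)
    (rectangles (complete_list 3) (complete_list 5) @ row_cycles [0..<3] cycles_2K5)"
  by code_simp

text \<open>Taking all rectangles twice covers a column edge 2 times 4 times but a row edge only
  twice; the six missing copies are three times 2K_5.\<close>

lemma decomposition_8_grid_2_5: "is_decomposition 8 (grid_list 2 5)
    (concat (replicate 2 (rectangles (complete_list 2) (complete_list 5))) @
     concat (replicate 3 (row_cycles [0..<2] cycles_2K5)))"
  by code_simp

text \<open>Five starter cycles, developed along the diagonal translations of \<open>\<int>\<^sub>5 \<times> \<int>\<^sub>5\<close>.\<close>

lemma decomposition_1_grid_5_5: "is_decomposition 1 (grid_list 5 5)
    [(s a, s b, s c, s d).
      s \<leftarrow> [\<lambda>(i, j). ((i + t) mod 5, (j + t) mod 5). t \<leftarrow> [0..<5]],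
      (a, b, c, d) \<leftarrow> [((0, 0), (0, 1), (0, 2), (0, 3)), ((0, 1), (0, 3), (1, 3), (1, 1)),
        ((0, 0), (0, 4), (1, 4), (1, 0)), ((0, 0), (2, 0), (4, 0), (3, 0)),
        ((0, 1), (0, 4), (2, 4), (2, 1))]]"
  by code_simp

text \<open>Eight rows \<open>K\<^sub>5\<close> and five columns \<open>K\<^sub>9\<close>: each row minus a 4-cycle is a bowtie, and the six
  bowtie edges are paired with the 1-factors \<open>{x, x + v}\<close> of \<open>K\<^sub>8\<close> on \<open>\<int>\<^sub>2\<^sup>3\<close>.\<close>

definition extension_list :: "((nat \<times> nat) \<times> (nat \<times> nat)) list" where
  "extension_list = [((i, a), (i, b)). i \<leftarrow> [0..<8], (a, b) \<leftarrow> complete_list 5]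
     @ [((a, j), (b, j)). j \<leftarrow> [0..<5], (a, b) \<leftarrow> complete_list 9]"

lemma decomposition_extension: "is_decomposition 1 extension_list
    (rectangles [(0, 1), (2, 3), (4, 5), (6, 7)] [(0, 1)] @
     rectangles [(0, 2), (1, 3), (4, 6), (5, 7)] [(0, 2)] @
     rectangles [(0, 3), (1, 2), (4, 7), (5, 6)] [(1, 2), (3, 4)] @
     rectangles [(0, 4), (1, 5), (2, 6), (3, 7)] [(0, 3)] @
     rectangles [(0, 5), (1, 4), (2, 7), (3, 6)] [(0, 4)] @
     row_cycles [0..<8] [(1, 3, 2, 4)] @
     column_cycles [0] [(0, 3, 5, 8), (0, 6, 1, 7), (1, 2, 4, 8), (2, 5, 6, 8), (3, 4, 7, 8)]
       @
     column_cycles [1] [(0, 2, 8, 6), (1, 3, 4, 6), (2, 5, 3, 6), (2, 4, 8, 7), (0, 4, 1, 8),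
       (0, 5, 1, 7), (3, 7, 5, 8)] @
     column_cycles [2] [(0, 1, 8, 6), (2, 6, 7, 8), (1, 6, 3, 7), (0, 4, 2, 7), (0, 5, 4, 8),
       (1, 4, 3, 5), (2, 3, 8, 5)] @
     column_cycles [3] [(0, 7, 5, 8), (2, 5, 4, 8), (0, 1, 3, 5), (0, 2, 3, 6), (1, 6, 8, 7),
       (1, 4, 3, 8), (2, 4, 6, 7)] @
     column_cycles [4] [(0, 2, 8, 6), (2, 3, 8, 4), (2, 5, 7, 6), (1, 3, 4, 6), (0, 1, 5, 4),
       (0, 7, 1, 8), (3, 5, 8, 7)])"
  by code_simp

section \<open>Sufficiency\<close>

abbreviation complete_decomposable :: "nat \<Rightarrow> nat \<Rightarrow> bool" where
  "complete_decomposable k n \<equiv> fold_decomposable k (complete {..<n})"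

abbreviation grid_decomposable :: "nat \<Rightarrow> nat \<Rightarrow> nat \<Rightarrow> bool" where
  "grid_decomposable k m n \<equiv> fold_decomposable k (grid {..<m} {..<n})"

lemma lessThan_add_split: "{..<a + b} = {..<a} \<union> {a..<a + b}" for a b :: nat
  by auto

lemma complete_trivial [simp]: "complete {} = {#}" "complete {x} = {#}"
  by (simp_all add: complete_edges_def)

lemma complete_decomposable_list:
  "is_decomposition k (complete_list n) cs \<Longrightarrow> complete_decomposable k n"
  using fold_decomposable_list by (metis edges_of_complete_list)

lemma grid_decomposable_list:
  "is_decomposition k (grid_list m n) cs \<Longrightarrow> grid_decomposable k m n"
  using fold_decomposable_list by (metis edges_of_grid_list)

lemma complete_decomposable_add:
  assumes "complete_decomposable k a" "complete_decomposable k b"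
    and "fold_decomposable k (bipartite {..<a} {a..<a + b})"
  shows "complete_decomposable k (a + b)"
proof -
  have "fold_decomposable k (complete {a..<a + b})"
    using assms(2) by (rule fold_decomposable_complete_card) auto
  moreover have "complete {..<a + b} = complete {..<a} + complete {a..<a + b} +
      bipartite {..<a} {a..<a + b}"
    unfolding lessThan_add_split by (rule complete_union) auto
  ultimately show ?thesis using assms by (simp add: fold_decomposable_add)
qed

lemma grid_decomposable_add:
  assumes "grid_decomposable k a n" "grid_decomposable k b n"
    and "fold_decomposable k (bipartite {..<a} {a..<a + b})"
  shows "grid_decomposable k (a + b) n"
proof -
  have "fold_decomposable k (grid ((+) a ` {..<b}) (id ` {..<n}))"
    using assms(2) by (rule fold_decomposable_grid_image) auto
  moreover have "(+) a ` {..<b} = {a..<a + b}"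
    by (simp add: lessThan_atLeast0 add.commute)
  ultimately have "fold_decomposable k (grid {a..<a + b} {..<n})" by simp
  moreover have "grid {..<a + b} {..<n} = grid {..<a} {..<n} + grid {a..<a + b} {..<n}
      + (\<Sum>j<n. image_mset ((`) (\<lambda>i. (i, j))) (bipartite {..<a} {a..<a + b}))"
    unfolding lessThan_add_split by (rule grid_union) auto
  ultimately show ?thesis
    using assms by (auto intro!: fold_decomposable_add fold_decomposable_sum
        fold_decomposable_inj_image simp: inj_on_def)
qed

lemma grid_decomposable_swap: "grid_decomposable k m n \<Longrightarrow> grid_decomposable k n m"
  by (rule fold_decomposable_grid_swap)

lemma grid_decomposable_complete:
  "complete_decomposable k m \<Longrightarrow> complete_decomposable k n \<Longrightarrow> grid_decomposable k m n"
  unfolding grid_def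
  by (auto intro!: fold_decomposable_add fold_decomposable_sum fold_decomposable_inj_image
      simp: inj_on_def)

lemma fold_decomposable_2_bipartite_interval:
  fixes a b :: nat
  assumes "a \<noteq> 1" "even b"
  shows "fold_decomposable 2 (bipartite {..<a} {a..<a + b})"
proof (cases "a = 0")
  case True
  then show ?thesis by (simp add: lessThan_0)
next
  case False
  then show ?thesis using assms by (intro fold_decomposable_2_bipartite) auto
qed

lemmas fold_decomposable_4_bipartite_interval =
  fold_decomposable_dvd[OF fold_decomposable_2_bipartite_interval, of _ _ 4, simplified]

lemmas fold_decomposable_8_bipartite_interval =
  fold_decomposable_dvd[OF fold_decomposable_2_bipartite_interval, of _ _ 8, simplified]

section \<open>Complete graphs that decompose by themselves\<close>

lemma complete_decomposable_1_9: "complete_decomposable 1 9"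
  using complete_decomposable_list[OF decomposition_K9] .

text \<open>The eight new vertices together with the old vertex \<open>0\<close> span a copy of \<open>K\<^sub>9\<close>.\<close>

lemma complete_add_8:
  fixes n :: nat
  assumes "n > 0"
  shows "complete {n..<n + 8} + bipartite {..<n} {n..<n + 8} =
    complete (insert 0 {n..<n + 8}) + bipartite {1..<n} {n..<n + 8}"
proof -
  have "complete ({0} \<union> {n..<n + 8}) = complete {0} + complete {n..<n + 8} + bipartite {0} {n..<n +
      8}"
    using assms by (intro complete_union) auto
  moreover have "bipartite ({0} \<union> {1..<n}) {n..<n + 8} = bipartite {0} {n..<n + 8} +
      bipartite {1..<n} {n..<n + 8}"
    using assms by (intro bipartite_union) auto
  moreover have "{0} \<union> {1..<n} = {..<n}" using assms by auto
  ultimately show ?thesis by simp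
qed

lemma fold_decomposable_K9_interval:
  fixes n :: nat
  assumes "n > 0"
  shows "fold_decomposable 1 (complete (insert 0 {n..<n + 8}))"
  by (rule fold_decomposable_complete_card[OF complete_decomposable_1_9]) (use assms in auto)

text \<open>The old vertices other than \<open>0\<close> are even in number, so their edges to the
  eight new vertices decompose. The increment \<open>R\<close> is stated apart from
  \<open>complete {..<n}\<close> because the latter need not decompose, as for
  \<open>n = 5\<close>.\<close>

lemma complete_odd_add_8:
  fixes n :: nat
  assumes "odd n"
  obtains R where "fold_decomposable 1 R" "complete {..<n + 8} = complete {..<n} + R"
proof
  have n: "n > 0" using assms by (auto intro: odd_pos)
  let ?R = "complete (insert 0 {n..<n + 8}) + bipartite {1..<n} {n..<n + 8}"
  show "fold_decomposable 1 ?R"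
    using fold_decomposable_K9_interval[OF n] assms
    by (intro fold_decomposable_add fold_decomposable_1_bipartite) auto
  have "complete {..<n + 8} = complete {..<n} + complete {n..<n + 8} + bipartite {..<n} {n..<n + 8}"
    unfolding lessThan_add_split by (rule complete_union) auto
  then show "complete {..<n + 8} = complete {..<n} + ?R"
    by (simp only: complete_add_8[OF n] add.assoc)
qed

lemma complete_odd_add_multiple_8:
  fixes n :: nat
  assumes "odd n"
  shows "\<exists>R. fold_decomposable 1 R \<and> complete {..<n + 8 * t} = complete {..<n} + R"
proof (induction t)
  case 0
  show ?case by (intro exI[of _ "{#}"]) simp
next
  case (Suc t)
  then obtain R where R: "fold_decomposable 1 R" "complete {..<n + 8 * t} = complete {..<n} + R"
    by blast
  obtain S where S: "fold_decomposable 1 S" "complete {..<n + 8 * t + 8} = complete {..<n + 8 * t} +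
      S"
    using complete_odd_add_8[of "n + 8 * t"] assms by auto
  have "complete {..<n + 8 * Suc t} = complete {..<n} + (R + S)"
    using R(2) S(2) by (simp add: algebra_simps)
  then show ?case using fold_decomposable_add[OF R(1) S(1)] by blast
qed

lemma complete_decomposable_1:
  assumes "n mod 8 = 1"
  shows "complete_decomposable 1 n"
proof -
  have "n = 1 + 8 * (n div 8)" using assms by presburger
  moreover obtain R where "fold_decomposable 1 R" "complete {..<1 + 8 * (n div 8)} =
      complete {..<1} + R"
    using complete_odd_add_multiple_8[of 1 "n div 8"] by auto
  moreover have "complete {..<1::nat} = {#}" by (simp add: lessThan_Suc lessThan_0)
  ultimately show ?thesis by simp
qed

lemma complete_decomposable_trivial: "n < 2 \<Longrightarrow> complete_decomposable k n"
  by (cases n) (auto simp: lessThan_Suc lessThan_0)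

lemma complete_decomposable_2:
  assumes "n mod 4 < 2"
  shows "complete_decomposable 2 n"
  using assms
proof (induction n rule: less_induct)
  case (less n)
  \<comment> \<open>The value 5 is a base case: stepping back to 1 would leave a star as the
    bipartite piece.\<close>
  consider "n < 2" | "n = 4" | "n = 5" | "n \<ge> 8" using less.prems by atomize_elim presburger
  then show ?case
  proof cases
    case 4
    have "n - 4 < n" "(n - 4) mod 4 < 2"
      using less.prems 4 by (simp_all add: le_mod_geq[symmetric])
    then have "complete_decomposable 2 (n - 4)" by (rule less.IH)
    then have "complete_decomposable 2 (n - 4 + 4)"
      using complete_decomposable_list[OF decomposition_2K4]
      by (rule complete_decomposable_add) (use 4 in \<open>intro fold_decomposable_2_bipartite_interval,
          auto\<close>)
    then show ?thesis using 4 by simp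
  qed (auto intro: complete_decomposable_trivial complete_decomposable_list[OF decomposition_2K4]
      complete_decomposable_list[OF decomposition_2K5])
qed

lemma complete_decomposable_4:
  assumes "n \<ge> 4"
  shows "complete_decomposable 4 n"
  using assms
proof (induction n rule: less_induct)
  case (less n)
  have small: "complete_decomposable 4 4" "complete_decomposable 4 5"
    by (rule fold_decomposable_dvd[OF complete_decomposable_2]; simp)+
  \<comment> \<open>Stepping back by 4 from 5, 6 or 7 would leave one vertex, and thus a star, or
    else K_2 or K_3.\<close>
  consider "n = 4" | "n = 5" | "n = 6" | "n = 7" | "n \<ge> 8" using less.prems by linarith
  then show ?case
  proof cases
    case 5
    then have "complete_decomposable 4 (n - 4)" by (intro less.IH) auto
    then have "complete_decomposable 4 (n - 4 + 4)"
      using small(1)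
      by (rule complete_decomposable_add) (use 5 in \<open>intro fold_decomposable_4_bipartite_interval,
          auto\<close>)
    then show ?thesis using 5 by simp
  qed (use small in \<open>auto intro: complete_decomposable_list[OF decomposition_4K6]
      complete_decomposable_list[OF decomposition_4K7]\<close>)
qed

section \<open>Grids whose rows or columns need not decompose by themselves\<close>

lemma grid_decomposable_empty: "grid_decomposable k 0 n"
  by (simp add: grid_def lessThan_0)

text \<open>The 2 by 2 grid is a single rectangle. Blocks of two rows or two columns are glued by
  bipartite graphs with even parts.\<close>

lemma grid_decomposable_even:
  assumes "even m" "even n"
  shows "grid_decomposable 1 m n"
proof -
  have step: "grid_decomposable 1 (2 * s) q" if "grid_decomposable 1 2 q" for q s
  proof (induction s)
    case (Suc s)
    have "grid_decomposable 1 (2 * s + 2) q"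
      using Suc that by (rule grid_decomposable_add) (intro fold_decomposable_1_bipartite, auto)
    then show ?case by simp
  qed (use grid_decomposable_empty in simp)
  have "is_decomposition 1 (grid_list 2 2) (rectangles [(0, 1)] [(0, 1)])"
    by code_simp
  then have "grid_decomposable 1 2 2" by (rule grid_decomposable_list)
  then have "grid_decomposable 1 2 n"
    using step assms(2) by (metis evenE grid_decomposable_swap)
  then show ?thesis using step assms(1) by (metis evenE)
qed

text \<open>A doubled column has 2 modulo 4 edges and cannot be treated alone. The mixed
  decomposition of the first three rows absorbs this, and further rows come in 4 by 4
  blocks.\<close>

lemma grid_decomposable_2_4: "grid_decomposable 2 (4 * t + 3) 4"
proof (induction t)
  case 0
  show ?case using grid_decomposable_list[OF decomposition_2_grid_3_4] by simp
next
  case (Suc t)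
  have "grid_decomposable 2 4 4"
    by (intro grid_decomposable_complete complete_decomposable_2) auto
  with Suc have "grid_decomposable 2 (4 * t + 3 + 4) 4"
    by (rule grid_decomposable_add) (intro fold_decomposable_2_bipartite_interval, auto)
  then show ?case by (simp add: algebra_simps)
qed

text \<open>The four new rows form a transposed instance of \<open>grid_decomposable_2_4\<close>.
  Excluding \<open>m = 1\<close> keeps the gluing piece from being a star.\<close>

lemma grid_decomposable_2_add_4:
  assumes "grid_decomposable 2 m n" "n mod 4 = 3" "m \<noteq> 1"
  shows "grid_decomposable 2 (m + 4 * t) n"
proof (induction t)
  case 0
  show ?case using assms(1) by simp
next
  case (Suc t)
  have "n = 4 * (n div 4) + 3" using assms(2) by presburger
  then have "grid_decomposable 2 4 n"
    using grid_decomposable_swap[OF grid_decomposable_2_4] by metis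
  with Suc have "grid_decomposable 2 (m + 4 * t + 4) n"
    by (rule grid_decomposable_add) (intro fold_decomposable_2_bipartite_interval,
        use assms(3) in presburger, simp)
  then show ?case by (simp add: algebra_simps)
qed

lemma grid_decomposable_2_0_3:
  assumes "m mod 4 = 0" "n mod 4 = 3"
  shows "grid_decomposable 2 m n"
proof -
  have "m = 0 + 4 * (m div 4)" using assms(1) by presburger
  then show ?thesis
    using grid_decomposable_2_add_4[OF grid_decomposable_empty assms(2), of "m div 4"] by simp
qed

lemma grid_decomposable_2_3_3:
  assumes "m mod 4 = 3" "n mod 4 = 3"
  shows "grid_decomposable 2 m n"
proof -
  have *: "3 + 4 * (q div 4) = q" if "q mod 4 = 3" for q :: nat using that by presburger
  have "grid_decomposable 2 3 3"
    using grid_decomposable_list[OF decomposition_2_grid_3_3] .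
  then have "grid_decomposable 2 n 3"
    using grid_decomposable_2_add_4[of 3 3 "n div 4"] *[OF assms(2)] by simp
  then show ?thesis
    using grid_decomposable_2_add_4[of 3 n "m div 4"] *[OF assms(1)] assms(2)
    by (simp add: grid_decomposable_swap)
qed

lemma edges_of_bipartite_list:
  "p \<le> m \<Longrightarrow> edges_of [(a, b). a \<leftarrow> [0..<p], b \<leftarrow> [m..<n]] = bipartite {..<p} {m..<n}"
proof (induction p)
  case 0
  show ?case by (simp add: edges_of_def lessThan_0)
next
  case (Suc p)
  have "edges_of (map (Pair p) [m..<n]) = bipartite {m..<n} {p}"
    using Suc.prems by (simp add: bipartite_singleton edges_of_def multiset.map_comp comp_def
        insert_commute)
  moreover have "bipartite ({..<p} \<union> {p}) {m..<n} = bipartite {..<p} {m..<n} +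
      bipartite {p} {m..<n}"
    using Suc.prems by (intro bipartite_union) auto
  ultimately show ?case
    using Suc by (simp add: lessThan_Suc bipartite_commute)
qed

text \<open>The rows are triangles, which contain no 4-cycle, so
  \<open>grid_decomposable_complete\<close> does not apply.\<close>

lemma grid_decomposable_4_3:
  assumes "m \<ge> 5" "m mod 4 = 1 \<or> m mod 4 = 2"
  shows "grid_decomposable 4 m 3"
  using assms
proof (induction m rule: less_induct)
  case (less m)
  have g: "grid_decomposable 4 3 3" "grid_decomposable 4 4 3"
    by (rule fold_decomposable_dvd[OF grid_decomposable_2_3_3] fold_decomposable_dvd[OF
        grid_decomposable_2_0_3]; simp)+
  consider "m = 5" | "m = 6" | "m \<ge> 9" using less.prems by atomize_elim presburger
  then show ?case
  proof cases
    case 1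
    then show ?thesis
      using grid_decomposable_swap[OF grid_decomposable_list[OF decomposition_4_grid_3_5]] by simp
  next
    \<comment> \<open>Stepping back by 4 would leave two rows. Instead two blocks of three rows are
      joined in every column by K_{3,3}, for which multiplicity 4 is available.\<close>
    case 2
    have "edges_of [(a, b). a \<leftarrow> [0..<3], b \<leftarrow> [3..<6]] = bipartite {..<3} {3..<3 + 3 :: nat}"
      using edges_of_bipartite_list[of 3 3 6] by simp
    then have "grid_decomposable 4 (3 + 3) 3"
      using fold_decomposable_list[OF decomposition_4K33] g by (intro grid_decomposable_add) auto
    then show ?thesis using 2 by simp
  next
    case 3
    have "m - 4 < m" "(m - 4) mod 4 = 1 \<or> (m - 4) mod 4 = 2"
      using less.prems 3 by (simp_all add: le_mod_geq[symmetric])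
    then have "grid_decomposable 4 (m - 4) 3" using 3 by (intro less.IH) auto
    then have "grid_decomposable 4 (m - 4 + 4) 3"
      using g(2)
      by (rule grid_decomposable_add) (use 3 in \<open>intro fold_decomposable_4_bipartite_interval,
          auto\<close>)
    then show ?thesis using 3 by simp
  qed
qed

text \<open>The induction starts at 5 because the 3 by 2 grid decomposes for no positive
  multiplicity, by \<open>grid_decomposable_two_rows\<close>.\<close>

lemma grid_decomposable_8_2:
  assumes "n \<ge> 5" "odd n"
  shows "grid_decomposable 8 n 2"
proof -
  have "grid_decomposable 8 (5 + 2 * t) 2" for t
  proof (induction t)
    case 0
    show ?case
      using grid_decomposable_swap[OF grid_decomposable_list[OF decomposition_8_grid_2_5]] by simp
  next
    case (Suc t)
    have "grid_decomposable 8 2 2"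
      by (rule fold_decomposable_dvd[OF grid_decomposable_even]) auto
    with Suc have "grid_decomposable 8 (5 + 2 * t + 2) 2"
      by (rule grid_decomposable_add) (intro fold_decomposable_8_bipartite_interval, auto)
    then show ?case by (simp add: algebra_simps)
  qed
  from this[of "(n - 5) div 2"] show ?thesis using assms by simp
qed

section \<open>Multiplicity 1 with both sides 5 modulo 8\<close>

lemma edges_of_extension_list:
  "edges_of extension_list = (\<Sum>i<8. image_mset ((`) (Pair i)) (complete {..<5})) +
    (\<Sum>j<5. image_mset ((`) (\<lambda>i. (i, j))) (complete {..<9}))"
proof -
  have "extension_list = concat (map (\<lambda>i. map (map_prod (Pair i) (Pair i)) (complete_list 5))
      [0..<8])
     @ concat (map (\<lambda>j. map (map_prod (\<lambda>i. (i, j)) (\<lambda>i. (i, j))) (complete_list 9)) [0..<5])"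
    by (simp add: extension_list_def map_prod_def case_prod_unfold)
  then show ?thesis
    unfolding edges_of_map_list[symmetric] edges_of_complete_list[symmetric]
        edges_of_append[symmetric]
    by (rule arg_cong)
qed

lemma fold_decomposable_extension:
  fixes m :: nat
  assumes "m > 0"
  shows "fold_decomposable 1 ((\<Sum>i\<in>{m..<m + 8}. image_mset ((`) (Pair i)) (complete {..<5::nat})) +
    (\<Sum>j<5. image_mset ((`) (\<lambda>i. (i, j))) (complete (insert 0 {m..<m + 8}))))"
proof -
  \<comment> \<open>Label 8 of the certificate is the shared old vertex. It occurs in the columns
    only, because the edges of row 0 belong to the old grid.\<close>
  define f where "f i = (if i = 8 then 0 else m + i)" for i :: nat
  let ?h = "map_prod f id :: nat \<times> nat \<Rightarrow> nat \<times> nat"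
  have inj: "inj f" using assms by (auto simp: f_def inj_on_def)
  have f8: "f ` {..<8} = {m..<m + 8}"
    using image_add_atLeastLessThan[of m 0 8] by (auto simp:
        f_def lessThan_atLeast0 image_iff Bex_def intro!: exI[of _ "_ - m"])
  have "{..<9::nat} = insert 8 {..<8}" by auto
  then have f9: "f ` {..<9} = insert 0 {m..<m + 8}"
    using f8 by (simp add: f_def[of 8])
  have "fold_decomposable 1 (image_mset ((`) ?h) (edges_of extension_list))"
    using fold_decomposable_list[OF decomposition_extension] inj
    by (intro fold_decomposable_inj_image) (auto simp: prod.inj_map)
  moreover have "image_mset ((`) ?h) (edges_of extension_list) =
    (\<Sum>i\<in>f ` {..<8}. image_mset ((`) (Pair i)) (complete {..<5})) +
    (\<Sum>j<5. image_mset ((`) (\<lambda>i. (i, j))) (complete (f ` {..<9})))"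
    using inj_on_subset[OF inj, of "{..<8}"] inj_on_subset[OF inj, of "{..<9}"]
    by (simp add: edges_of_extension_list image_mset_sum multiset.map_comp comp_def image_image
        complete_image sum.reindex)
  ultimately show ?thesis by (simp only: f8 f9)
qed

lemma grid_decomposable_1_add_8:
  assumes "grid_decomposable 1 m n" "odd m" "n mod 8 = 5"
  shows "grid_decomposable 1 (m + 8) n"
proof -
  have m: "m > 0" using assms(2) by (rule odd_pos)
  define N where "N = {m..<m + 8}"
  let ?row = "\<lambda>i. image_mset ((`) (Pair i))" and ?col = "\<lambda>j. image_mset ((`) (\<lambda>i. (i, j)))"
  let ?K9 = "complete (insert 0 N)" and ?B = "bipartite {1..<m} N"
  have "5 + 8 * (n div 8) = n" using assms(3) by presburger
  then obtain R where R: "fold_decomposable 1 R" "complete {..<n} = complete {..<5} + R"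
    using complete_odd_add_multiple_8[of 5 "n div 8"] by auto
  have "n \<ge> 5" using assms(3) by presburger
  then have n5: "{..<n} = {..<5} \<union> {5..<n}" by auto
  have split: "(\<Sum>j<n. f j) = (\<Sum>j<5. f j) + (\<Sum>j\<in>{5..<n}. f j)"
    for f :: "nat \<Rightarrow> (nat \<times> nat) set multiset"
    unfolding n5 by (rule sum.union_disjoint) auto
  have K9: "complete N + bipartite {..<m} N = ?K9 + ?B"
    unfolding N_def by (rule complete_add_8[OF m])
  have "grid {..<m + 8} {..<n} = grid {..<m} {..<n} + grid N {..<n} +
      (\<Sum>j<n. ?col j (bipartite {..<m} N))"
    unfolding lessThan_add_split N_def by (rule grid_union) auto
  also have "\<dots> = grid {..<m} {..<n} + (\<Sum>i\<in>N. ?row i (complete {..<n})) +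
      (\<Sum>j<n. ?col j (complete N + bipartite {..<m} N))"
    by (simp only: grid_def[of N] image_mset_union sum.distrib add.assoc)
  also have "\<dots> = grid {..<m} {..<n} + (\<Sum>i\<in>N. ?row i (complete {..<5})) + (\<Sum>i\<in>N. ?row i R) +
      ((\<Sum>j<5. ?col j ?K9) + (\<Sum>j\<in>{5..<n}. ?col j ?K9) + (\<Sum>j<n. ?col j ?B))"
    by (simp only: R(2) K9 image_mset_union sum.distrib split[of "\<lambda>j. ?col j ?K9"] add.assoc)
  \<comment> \<open>The second group is the certificate. The third decomposes piece by piece:
    \<open>R\<close> by its choice, each K_9 alone, and \<open>?B\<close> because
    \<open>{1..<m}\<close> has even size.\<close>
  also have "\<dots> = grid {..<m} {..<n} +
      ((\<Sum>i\<in>N. ?row i (complete {..<5})) + (\<Sum>j<5. ?col j ?K9)) +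
      ((\<Sum>i\<in>N. ?row i R) + (\<Sum>j\<in>{5..<n}. ?col j ?K9) + (\<Sum>j<n. ?col j ?B))"
    by (simp only: ac_simps)
  finally have *: "grid {..<m + 8} {..<n} = \<dots>" .
  have "fold_decomposable 1 ?B"
    unfolding N_def using assms(2) by (intro fold_decomposable_1_bipartite) auto
  moreover have "fold_decomposable 1 ?K9"
    unfolding N_def by (rule fold_decomposable_K9_interval[OF m])
  ultimately have rest: "fold_decomposable 1
      ((\<Sum>i\<in>N. ?row i R) + (\<Sum>j\<in>{5..<n}. ?col j ?K9) + (\<Sum>j<n. ?col j ?B))"
    using R(1)
    by (intro fold_decomposable_add fold_decomposable_sum fold_decomposable_inj_image)
      (simp_all add: inj_on_def)
  show ?thesis
    unfolding * using assms(1) fold_decomposable_extension[OF m, folded N_def] rest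
    by (rule fold_decomposable_add[OF fold_decomposable_add])
qed

lemma grid_decomposable_1_5_5:
  assumes "m mod 8 = 5" "n mod 8 = 5"
  shows "grid_decomposable 1 m n"
proof -
  have step: "grid_decomposable 1 (5 + 8 * t) q" if "grid_decomposable 1 5 q" "q mod 8 = 5" for t q
  proof (induction t)
    case 0
    show ?case using that by simp
  next
    case (Suc t)
    then have "grid_decomposable 1 (5 + 8 * t + 8) q"
      using that by (intro grid_decomposable_1_add_8) auto
    then show ?case by (simp add: algebra_simps)
  qed
  have *: "5 + 8 * (q div 8) = q" if "q mod 8 = 5" for q :: nat using that by presburger
  \<comment> \<open>The 5 by 5 grid is lengthened in one direction, transposed, and then lengthened
    in the other.\<close>
  have "grid_decomposable 1 n 5"
    using step[of 5 "n div 8", unfolded *[OF assms(2)]] grid_decomposable_list[OF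
        decomposition_1_grid_5_5]
    by simp
  then show ?thesis
    using step[of n "m div 8", unfolded *[OF assms(1)]] assms(2) by (simp add:
        grid_decomposable_swap)
qed

section \<open>Matching the divisibility conditions with the available multiplicities\<close>

lemma dvd_mult_odd_cancel: "2 ^ k dvd l * a \<Longrightarrow> odd a \<Longrightarrow> 2 ^ k dvd l" for l a :: nat
  by (simp add: coprime_dvd_mult_left_iff)

text \<open>Here \<open>m + n - 2\<close> is odd, so the degree condition gives
  \<open>2 dvd l\<close>. If \<open>m\<close> is twice an odd number, the size condition improves
  this to \<open>4 dvd l\<close>; for \<open>m = 2\<close> the factor 8 comes from
  \<open>two\<close>.\<close>

lemma grid_decomposable_even_odd:
  assumes "m > 0" "m * n \<ge> 4" "even m" "odd n"
    and deg: "2 dvd l * (m + n - 2)" and size: "8 dvd l * m * n * (m + n - 2)"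
    and two: "m = 2 \<Longrightarrow> n \<ge> 5 \<and> 8 dvd l"
  shows "grid_decomposable l m n"
proof -
  have odd: "odd (m + n - 2)" using assms(1,3,4) by (auto elim!: evenE oddE)
  consider "m mod 4 = 0" "n mod 4 = 1" | "m mod 4 = 0" "n mod 4 = 3" | "m = 2" | "m \<ge> 6" "m mod 4 =
      2"
    using assms(1,3,4) by atomize_elim presburger
  then show ?thesis
  proof cases
    case 1
    then have "grid_decomposable 2 m n"
      by (intro grid_decomposable_complete complete_decomposable_2) auto
    then show ?thesis using deg dvd_mult_odd_cancel[of 1 l] odd fold_decomposable_dvd by auto
  next
    case 2
    then have "grid_decomposable 2 m n" by (rule grid_decomposable_2_0_3)
    then show ?thesis using deg dvd_mult_odd_cancel[of 1 l] odd fold_decomposable_dvd by auto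
  next
    case 3
    then have "grid_decomposable 8 m n"
      using two assms(4) grid_decomposable_8_2 grid_decomposable_swap by blast
    then show ?thesis using 3 two fold_decomposable_dvd by blast
  next
    case 4
    define q where "q = m div 2"
    have q: "m = 2 * q" "odd q" using 4(2) unfolding q_def by presburger+
    have "8 dvd 2 * (l * (q * n * (m + n - 2)))"
      using size by (simp add: q(1) ac_simps)
    then have "2 ^ 2 dvd l * (q * n * (m + n - 2))" by (simp add: ac_simps)
    then have "2 ^ 2 dvd l" by (rule dvd_mult_odd_cancel) (use q assms(4) odd in simp)
    moreover have "grid_decomposable 4 m n"
    proof (cases "n = 3")
      case True
      then show ?thesis using 4 grid_decomposable_4_3 by simp
    next
      case False
      then have "n < 2 \<or> n \<ge> 4" using assms(4) by presburger
      then show ?thesis using 4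
        by (intro grid_decomposable_complete) (auto intro:
            complete_decomposable_4 complete_decomposable_trivial)
    qed
    ultimately show ?thesis using fold_decomposable_dvd by simp
  qed
qed

text \<open>Here \<open>m + n - 2\<close> is twice an odd number, so the size condition forces
  \<open>4 dvd l\<close>.\<close>

lemma grid_decomposable_1_3_mod_4:
  assumes "m * n \<ge> 4" "m mod 4 = 1" "n mod 4 = 3" and size: "8 dvd l * m * n * (m + n - 2)"
  shows "grid_decomposable l m n"
proof -
  obtain q where q: "m + n - 2 = 2 * q" "odd q"
  proof
    have "m = 4 * (m div 4) + 1" "n = 4 * (n div 4) + 3" using assms(2,3) by presburger+
    then have "m + n - 2 = 4 * (m div 4) + 1 + (4 * (n div 4) + 3) - 2" by (rule arg_cong2)
    then show "m + n - 2 = 2 * (2 * (m div 4) + 2 * (n div 4) + 1)" by simp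
  qed simp
  have odd: "odd m" "odd n" using assms(2,3) by presburger+
  have "8 dvd 2 * (l * (m * n * q))"
    using size unfolding q by (simp add: ac_simps)
  then have "2 ^ 2 dvd l * (m * n * q)" by (simp add: ac_simps)
  then have "2 ^ 2 dvd l" by (rule dvd_mult_odd_cancel) (use q odd in simp)
  moreover have "grid_decomposable 4 m n"
  proof (cases "n = 3")
    case True
    \<comment> \<open>The bound on \<open>m * n\<close> rules out the 1 by 3 grid, a
      triangle.\<close>
    then have "m \<ge> 5" using assms(1,2) by (cases "m = 1") presburger+
    then show ?thesis using True assms(2) grid_decomposable_4_3 by simp
  next
    case False
    then have "n \<ge> 4" "m < 2 \<or> m \<ge> 4" using assms(2,3) by presburger+
    then show ?thesis
      by (intro grid_decomposable_complete) (auto intro: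
          complete_decomposable_4 complete_decomposable_trivial)
  qed
  ultimately show ?thesis using fold_decomposable_dvd by simp
qed

text \<open>If \<open>m + n\<close> is 6 modulo 8, then \<open>m + n - 2\<close> is 4 times an odd
  number and the size condition forces \<open>l\<close> to be even. If \<open>m + n\<close> is 2
  modulo 8, the size condition is vacuous: residues 1, 1 and 5, 5 get multiplicity 1, while 3 with 7
  relies on \<open>three\<close>.\<close>

lemma grid_decomposable_odd:
  assumes "m * n \<ge> 4" "odd m" "odd n" and size: "8 dvd l * m * n * (m + n - 2)"
    and three: "m mod 8 = 3 \<and> n mod 8 = 7 \<or> n mod 8 = 3 \<and> m mod 8 = 7 \<Longrightarrow> even l"
  shows "grid_decomposable l m n"
proof -
  have even: "even l" if "(m + n) mod 8 = 6"
  proof -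
    define c where "c = (m + n) div 8"
    have "m + n = 8 * c + 6" using that unfolding c_def by presburger
    then have "m + n - 2 = 4 * (2 * c + 1)" by simp
    then obtain q where q: "m + n - 2 = 4 * q" "odd q" by fastforce
    have "8 dvd 4 * (l * (m * n * q))"
      using size unfolding q by (simp add: ac_simps)
    then have "2 ^ 1 dvd l * (m * n * q)" by (simp add: ac_simps)
    then have "2 ^ 1 dvd l" by (rule dvd_mult_odd_cancel) (use q assms in simp)
    then show ?thesis by simp
  qed
  consider "m mod 8 = 1" "n mod 8 = 1" | "m mod 8 = 5" "n mod 8 = 5"
    | "m mod 4 = 1" "n mod 4 = 1" "(m + n) mod 8 = 6"
    | "m mod 4 = 3" "n mod 4 = 3" "(m + n) mod 8 = 6"
    | "m mod 4 = 3" "n mod 4 = 3" "m mod 8 = 3 \<and> n mod 8 = 7 \<or> n mod 8 = 3 \<and> m mod 8 = 7"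
    | "m mod 4 = 1" "n mod 4 = 3" | "n mod 4 = 1" "m mod 4 = 3"
  proof -
    have *: "q mod 8 = 1 \<and> q mod 4 = 1 \<or> q mod 8 = 3 \<and> q mod 4 = 3 \<or>
        q mod 8 = 5 \<and> q mod 4 = 1 \<or> q mod 8 = 7 \<and> q mod 4 = 3" if "odd q" for q :: nat
      using that by presburger
    have "(m + n) mod 8 = (m mod 8 + n mod 8) mod 8" by (simp add: mod_simps)
    with *[OF assms(2)] *[OF assms(3)] show ?thesis
      using that by (elim disjE conjE) simp_all
  qed
  then show ?thesis
  proof cases
    case 1
    then have "grid_decomposable 1 m n"
      by (intro grid_decomposable_complete complete_decomposable_1) auto
    then show ?thesis by (rule fold_decomposable_dvd) simp
  next
    case 2
    then have "grid_decomposable 1 m n" by (rule grid_decomposable_1_5_5)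
    then show ?thesis by (rule fold_decomposable_dvd) simp
  next
    case 3
    then have "grid_decomposable 2 m n"
      by (intro grid_decomposable_complete complete_decomposable_2) auto
    then show ?thesis by (rule fold_decomposable_dvd) (use even 3 in simp)
  next
    case 4
    then have "grid_decomposable 2 m n" by (intro grid_decomposable_2_3_3)
    then show ?thesis by (rule fold_decomposable_dvd) (use even 4 in simp)
  next
    case 5
    then have "grid_decomposable 2 m n" by (intro grid_decomposable_2_3_3)
    then show ?thesis by (rule fold_decomposable_dvd) (use three 5 in simp)
  next
    case 6
    then show ?thesis using assms grid_decomposable_1_3_mod_4 by blast
  next
    case 7
    have "8 dvd l * n * m * (n + m - 2)" "n * m \<ge> 4"
      using size assms(1) by (simp_all add: ac_simps)
    with 7 show ?thesis using grid_decomposable_1_3_mod_4 grid_decomposable_swap by blast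
  qed
qed

section \<open>From multigraphs to edge multisets\<close>

definition cycle_copies :: "('v set \<times> nat) set \<Rightarrow> bool" where
  "cycle_copies C \<longleftrightarrow> (\<exists>a b c d i j k l. distinct [a, b, c, d] \<and>
     C = {({a, b}, i), ({b, c}, j), ({c, d}, k), ({d, a}, l)})"

lemma cycle_edges_distinct:
  assumes "distinct [a, b, c, d]"
  shows "distinct [{a, b}, {b, c}, {c, d}, {d, a}]"
  using assms by (auto simp: doubleton_eq_iff)

lemma partition_on_Un_singleton:
  assumes "partition_on A P" "A \<inter> C = {}" "C \<noteq> {}"
  shows "partition_on (A \<union> C) (P \<union> {C})"
  using assms unfolding partition_on_def disjoint_def by auto

text \<open>The copies of \<open>e\<close> are numbered below \<open>count M e\<close>, so a new
  copy takes the first free number. Since the four edges are distinct, each of their counts grows by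
  exactly one.\<close>

lemma count_less_add_four:
  assumes "distinct [p, q, r, s]"
  shows "{(e, k). k < count (M + {#p, q, r, s#}) e} =
    {(e, k). k < count M e} \<union> {(p, count M p), (q, count M q), (r, count M r), (s, count M s)}"
proof -
  have "count (M + {#p, q, r, s#}) e = (if e \<in> {p, q, r, s} then Suc (count M e) else count M e)"
      for e
    using assms by auto
  then show ?thesis
    by (simp only: set_eq_iff split_paired_All mem_Collect_eq case_prod_conv)
      (auto simp: less_Suc_eq simp del: count_add_mset count_union split: if_splits)
qed

lemma C4_decomposable_imp_partition:
  assumes "C4_decomposable M"
  shows "\<exists>P. partition_on {(e, k). k < count M e} P \<and> (\<forall>C\<in>P. cycle_copies C)"
  using assms
proof induction
  case empty
  show ?case by (intro exI[of _ "{}"]) (simp add: partition_on_def)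
next
  case (add M a b c d)
  then obtain P where P: "partition_on {(e, k). k < count M e} P" "\<forall>C\<in>P. cycle_copies C"
    by blast
  let ?C = "{({a, b}, count M {a, b}), ({b, c}, count M {b, c}), ({c, d}, count M {c, d}), ({d, a},
      count M {d, a})}"
  let ?N = "M + {#{a, b}, {b, c}, {c, d}, {d, a}#}"
  have eq: "{(e, k). k < count ?N e} = {(e, k). k < count M e} \<union> ?C"
    by (rule count_less_add_four[OF cycle_edges_distinct[OF add.hyps(2)]])
  have disj: "{(e, k). k < count M e} \<inter> ?C = {}" by auto
  have "partition_on ({(e, k). k < count M e} \<union> ?C) (P \<union> {?C})"
    by (rule partition_on_Un_singleton[OF P(1) disj]) simp
  moreover have "cycle_copies ?C"
    unfolding cycle_copies_def using add.hyps(2) by blast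
  ultimately show ?case
    using P(2) unfolding eq by blast
qed

lemma mset_set_UN_disjoint:
  assumes "finite I" "\<And>i. i \<in> I \<Longrightarrow> finite (F i)"
    and "\<And>i j. i \<in> I \<Longrightarrow> j \<in> I \<Longrightarrow> i \<noteq> j \<Longrightarrow> F i \<inter> F j = {}"
  shows "mset_set (\<Union>i\<in>I. F i) = (\<Sum>i\<in>I. mset_set (F i))"
  using assms
proof (induction I rule: finite_induct)
  case (insert x I)
  have "F x \<inter> (\<Union>i\<in>I. F i) = {}" using insert.prems insert.hyps by (simp; blast)
  then show ?case using insert by (simp add: mset_set_Union)
qed simp

text \<open>From multisets to multigraphs the copies are numbered. Conversely \<open>fst\<close>
  forgets the numbers, and the images of the parts add up to the \<open>k\<close>-fold edge
  multiset.\<close>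

lemma has_C4_decomposition_lambda_fold:
  assumes "simple_graph G" "finite (edges G)"
  shows "has_C4_decomposition (lambda_fold k G) \<longleftrightarrow> fold_decomposable k (mset_set (edges G))"
proof
  assume "fold_decomposable k (mset_set (edges G))"
  from C4_decomposable_imp_partition[OF this[unfolded fold_decomposable_def]]
  obtain P where P: "partition_on {(e, i). i < count (repeat_mset k (mset_set (edges G))) e} P"
      "\<forall>C\<in>P. cycle_copies C"
    by blast
  have E: "{(e, i). i < count (repeat_mset k (mset_set (edges G))) e} = medges (lambda_fold k G)"
    using assms(2) by (auto simp: lambda_fold_def count_mset_set' split: if_splits)
  have "\<exists>H. submultigraph H (lambda_fold k G) \<and> is_C4 H \<and> medges H = C" if C: "C \<in> P" for C
  proof -
    have sub: "C \<subseteq> edges G \<times> {..<k}"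
      using partition_onD1[OF P(1)] C unfolding E by (auto simp: lambda_fold_def)
    obtain a b c d i j q l where *: "distinct [a, b, c, d]"
      "C = {({a, b}, i), ({b, c}, j), ({c, d}, q), ({d, a}, l)}"
      using P(2) C unfolding cycle_copies_def by metis
    let ?H = "\<lparr>mverts = {a, b, c, d}, medges = C, mends = fst\<rparr>"
    have ends: "fst e \<subseteq> verts G \<and> card (fst e) = 2" if "e \<in> C" for e
    proof -
      have "fst e \<in> edges G" using sub that by auto
      then show ?thesis using assms(1) by (simp add: simple_graph_def)
    qed
    have "{a, b} \<subseteq> verts G" "{c, d} \<subseteq> verts G"
      using ends[of "({a, b}, i)"] ends[of "({c, d}, q)"] *(2) by simp_all
    then have "{a, b, c, d} \<subseteq> verts G" by simp
    moreover have "fst e \<subseteq> {a, b, c, d}" if "e \<in> C" for e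
      using that *(2) by auto
    ultimately have "submultigraph ?H (lambda_fold k G)"
      using sub ends by (simp add: submultigraph_def multigraph_def lambda_fold_def)
    moreover have "is_C4 ?H"
      unfolding is_C4_def
      by (intro exI[of _ a] exI[of _ b] exI[of _ c] exI[of _ d] exI[of _ "({a, b}, i)"]
          exI[of _ "({b, c}, j)"] exI[of _ "({c, d}, q)"] exI[of _ "({d, a}, l)"] conjI)
        (simp_all only: mgraph.simps fst_conv *)
    ultimately show ?thesis by (intro exI[of _ ?H]) simp
  qed
  then show "has_C4_decomposition (lambda_fold k G)"
    unfolding has_C4_decomposition_def using P(1) unfolding E by blast
next
  assume "has_C4_decomposition (lambda_fold k G)"
  then obtain P where P: "partition_on (edges G \<times> {..<k}) P"
    "\<And>C. C \<in> P \<Longrightarrow> \<exists>H. submultigraph H (lambda_fold k G) \<and> is_C4 H \<and> medges H = C"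
    unfolding has_C4_decomposition_def lambda_fold_def by auto
  have fin: "finite (edges G \<times> {..<k})" using assms(2) by simp
  have finP: "finite P" using finite_elements[OF fin P(1)] .
  have "C4_decomposable (image_mset fst (mset_set C))" if C: "C \<in> P" for C
  proof -
    obtain H where H: "submultigraph H (lambda_fold k G)" "is_C4 H" "medges H = C"
      using P(2)[OF C] by blast
    then obtain a b c d e0 e1 e2 e3 where *: "distinct [a, b, c, d]" "C = {e0, e1, e2, e3}"
      "mends H e0 = {a, b}" "mends H e1 = {b, c}" "mends H e2 = {c, d}" "mends H e3 = {d, a}"
      unfolding is_C4_def by blast
    have "mends H e = fst e" if "e \<in> C" for e
      using H that by (simp add: submultigraph_def lambda_fold_def)
    then have fst: "fst e0 = {a, b}" "fst e1 = {b, c}" "fst e2 = {c, d}" "fst e3 = {d, a}"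
      using *(2-6) by simp_all
    have "distinct (map fst [e0, e1, e2, e3])"
      using cycle_edges_distinct[OF *(1)] by (simp only: list.map fst)
    then have "mset_set (set [e0, e1, e2, e3]) = mset [e0, e1, e2, e3]"
      by (intro mset_set_set) (simp only: distinct_map)
    then have "image_mset fst (mset_set C) = {#{a, b}, {b, c}, {c, d}, {d, a}#}"
      by (simp only: *(2) list.set mset.simps image_mset_add_mset image_mset_empty fst)
    then show ?thesis using C4_decomposable_cycle[OF *(1)] by (simp only:)
  qed
  moreover have "repeat_mset k (mset_set (edges G)) = (\<Sum>C\<in>P. image_mset fst (mset_set C))"
  proof -
    have "repeat_mset k (mset_set (edges G)) = image_mset fst (mset_set (edges G \<times> {..<k}))"
    proof (rule multiset_eqI)
      fix e
      have "{x \<in> edges G \<times> {..<k}. e = fst x} = (if e \<in> edges G then {e} \<times> {..<k} else {})"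
        by auto
      then show "count (repeat_mset k (mset_set (edges G))) e =
          count (image_mset fst (mset_set (edges G \<times> {..<k}))) e"
        using assms(2) fin
        by (simp add: count_image_mset' count_mset_set' sum.If_cases) (auto simp: Times_Int_Times)
    qed
    also have "mset_set (edges G \<times> {..<k}) = (\<Sum>C\<in>P. mset_set C)"
    proof -
      have "finite C" if "C \<in> P" for C
        using partition_onD1[OF P(1)] that fin by (metis Sup_upper finite_subset)
      moreover have "C \<inter> D = {}" if "C \<in> P" "D \<in> P" "C \<noteq> D" for C D
        using partition_onD2[OF P(1)] that by (rule disjointD)
      ultimately show ?thesis
        using mset_set_UN_disjoint[OF finP, of "\<lambda>C. C"] partition_onD1[OF P(1)] by simp
    qed
    finally show ?thesis by (simp add: image_mset_sum)
  qed
  ultimately show "fold_decomposable k (mset_set (edges G))"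
    unfolding fold_decomposable_def by (simp add: C4_decomposable_sum)
qed

section \<open>The line graph of K_{m,n} as the Cartesian product of K_m and K_n\<close>

definition grid_edges :: "nat \<Rightarrow> nat \<Rightarrow> (nat \<times> nat) set set" where
  "grid_edges m n = {{(i, j), (i', j')} | i j i' j'. i < m \<and> i' < m \<and> j < n \<and> j' < n \<and>
     (i = i' \<and> j \<noteq> j' \<or> i \<noteq> i' \<and> j = j')}"

lemma image_complete_edges:
  assumes "inj f" "finite A"
  shows "mset_set ((`) f ` complete_edges A) = image_mset ((`) f) (complete A)"
    "finite ((`) f ` complete_edges A)"
proof -
  have "inj_on ((`) f) (complete_edges A)"
    using assms(1) by (simp add: inj_on_def inj_image_eq_iff)
  then show "mset_set ((`) f ` complete_edges A) = image_mset ((`) f) (complete A)"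
    by (simp add: image_mset_mset_set)
  show "finite ((`) f ` complete_edges A)" using assms(2) by simp
qed

lemma image_complete_edges_eq:
  "(`) f ` complete_edges A = {{f a, f b} | a b. a \<in> A \<and> b \<in> A \<and> a \<noteq> b}"
proof -
  have "(`) f ` complete_edges A = {f ` {a, b} | a b. a \<in> A \<and> b \<in> A \<and> a \<noteq> b}"
    unfolding complete_edges_def by blast
  then show ?thesis by simp
qed

lemma grid_eq_mset_set: "grid {..<m} {..<n} = mset_set (grid_edges m n)"
  and finite_grid_edges: "finite (grid_edges m n)"
proof -
  define R where "R i = (`) (Pair i) ` complete_edges {..<n}" for i :: nat
  define C where "C j = (`) (\<lambda>i. (i, j)) ` complete_edges {..<m}" for j :: nat
  have R: "R i = {{(i, j), (i, j')} | j j'. j < n \<and> j' < n \<and> j \<noteq> j'}" for i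
    by (simp add: R_def image_complete_edges_eq)
  have C: "C j = {{(i, j), (i', j)} | i i'. i < m \<and> i' < m \<and> i \<noteq> i'}" for j
    by (simp add: C_def image_complete_edges_eq)
  have eq: "grid_edges m n = (\<Union>i<m. R i) \<union> (\<Union>j<n. C j)"
    unfolding R C grid_edges_def by blast
  have fst: "fst ` e = {i}" if "e \<in> R i" for e i
    using that unfolding R by auto
  have snd: "snd ` e = {j}" if "e \<in> C j" for e j
    using that unfolding C by auto
  have "snd ` e \<noteq> {j}" if "e \<in> R i" for e i j
    using that unfolding R by auto
  with snd have disj: "R i \<inter> C j = {}" for i j
    by (metis disjoint_iff)
  have disj_R: "R i \<inter> R i' = {}" if "i \<noteq> i'" for i i'
    using fst that by (metis disjoint_iff singleton_inject)
  have disj_C: "C j \<inter> C j' = {}" if "j \<noteq> j'" for j j'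
    using snd that by (metis disjoint_iff singleton_inject)
  have inj: "inj (Pair i)" "inj (\<lambda>i. (i, j))" for i j :: nat by (auto simp: inj_on_def)
  have fin: "finite (R i)" "finite (C j)" for i j
    unfolding R_def C_def by (intro image_complete_edges(2) inj finite_lessThan)+
  show "finite (grid_edges m n)" unfolding eq using fin by simp
  have "mset_set (grid_edges m n) = mset_set (\<Union>i<m. R i) + mset_set (\<Union>j<n. C j)"
    unfolding eq by (rule mset_set_Union) (use fin disj in \<open>simp_all add: disjoint_iff, blast\<close>)
  also have "mset_set (\<Union>i<m. R i) = (\<Sum>i<m. mset_set (R i))"
    by (rule mset_set_UN_disjoint) (use fin disj_R in auto)
  also have "mset_set (\<Union>j<n. C j) = (\<Sum>j<n. mset_set (C j))"
    by (rule mset_set_UN_disjoint) (use fin disj_C in auto)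
  finally show "grid {..<m} {..<n} = mset_set (grid_edges m n)"
    by (simp add: grid_def R_def C_def image_complete_edges(1) inj)
qed

definition bip_edge :: "nat \<times> nat \<Rightarrow> (nat + nat) set" where
  "bip_edge = (\<lambda>(i, j). {Inl i, Inr j})"

lemma inj_bip_edge: "inj bip_edge"
  by (auto simp: bip_edge_def inj_on_def doubleton_eq_iff)

lemma card_bip_edge_Int:
  "card (bip_edge (i, j) \<inter> bip_edge (i', j')) = 1 \<longleftrightarrow> (i = i' \<and> j \<noteq> j' \<or> i \<noteq> i' \<and> j = j')"
  by (cases "i = i'"; cases "j = j'") (auto simp: bip_edge_def)

lemma edges_line_graph_complete_bipartite:
  "edges (line_graph (complete_bipartite m n)) = (`) bip_edge ` grid_edges m n"
proof -
  have "edges (complete_bipartite m n) = {bip_edge (i, j) | i j. i < m \<and> j < n}"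
    by (simp add: complete_bipartite_def bip_edge_def)
  then have "edges (line_graph (complete_bipartite m n)) =
    {{bip_edge (i, j), bip_edge (i', j')} | i j i' j'. i < m \<and> i' < m \<and> j < n \<and> j' < n \<and>
     card (bip_edge (i, j) \<inter> bip_edge (i', j')) = 1}"
    by (simp add: line_graph_def) blast
  also have "\<dots> = {{bip_edge (i, j), bip_edge (i', j')} | i j i' j'. i < m \<and> i' < m \<and> j < n \<and>
      j' < n \<and>
     (i = i' \<and> j \<noteq> j' \<or> i \<noteq> i' \<and> j = j')}"
    unfolding card_bip_edge_Int ..
  also have "\<dots> = {bip_edge ` {(i, j), (i', j')} | i j i' j'. i < m \<and> i' < m \<and> j < n \<and> j' < n \<and>
     (i = i' \<and> j \<noteq> j' \<or> i \<noteq> i' \<and> j = j')}"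
    by simp
  also have "\<dots> = (`) bip_edge ` grid_edges m n"
    unfolding grid_edges_def by blast
  finally show ?thesis .
qed

lemma has_C4_decomposition_grid:
  "has_C4_decomposition (lambda_fold k (line_graph (complete_bipartite m n))) \<longleftrightarrow>
    fold_decomposable k (grid {..<m} {..<n})"
proof -
  have inj: "inj_on ((`) bip_edge) (grid_edges m n)"
    by (simp add: inj_on_def inj_image_eq_iff[OF inj_bip_edge])
  have "fold_decomposable k (image_mset ((`) bip_edge) M) \<longleftrightarrow> fold_decomposable k M" for M
  proof
    \<comment> \<open>Decompositions are pulled back along \<open>inv bip_edge\<close>, which is
      injective on the range of \<open>bip_edge\<close>.\<close>
    assume *: "fold_decomposable k (image_mset ((`) bip_edge) M)"
    have "inj_on (inv bip_edge) (\<Union>(set_mset (image_mset ((`) bip_edge) M)))"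
      by (rule inj_on_subset[OF inj_on_inv_into[OF subset_refl]]) auto
    from fold_decomposable_image[OF * this] show "fold_decomposable k M"
      by (simp add: multiset.map_comp comp_def image_image inj_bip_edge)
  qed (rule fold_decomposable_inj_image[OF _ inj_bip_edge])
  moreover have "mset_set (edges (line_graph (complete_bipartite m n))) =
      image_mset ((`) bip_edge) (grid {..<m} {..<n})"
    using inj by (simp add: edges_line_graph_complete_bipartite grid_eq_mset_set
        image_mset_mset_set)
  moreover have "finite (edges (line_graph (complete_bipartite m n)))"
    by (simp add: edges_line_graph_complete_bipartite finite_grid_edges)
  ultimately show ?thesis
    by (simp add: has_C4_decomposition_lambda_fold simple_graph_line_graph
        simple_graph_complete_bipartite)
qed

section \<open>Necessity\<close>

abbreviation number :: "('v set \<Rightarrow> bool) \<Rightarrow> 'v set multiset \<Rightarrow> nat" where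
  "number P M \<equiv> size (filter_mset P M)"

lemma number_sum: "number P (\<Sum>i\<in>I. F i) = (\<Sum>i\<in>I. number P (F i))"
  by (induction I rule: infinite_finite_induct) auto

lemma number_repeat: "number P (repeat_mset k M) = k * number P M"
  by (induction k) auto

lemma number_image_complete:
  "finite A \<Longrightarrow> number P (image_mset f (complete A)) = card {e \<in> complete_edges A. P (f e)}"
  by (simp add: filter_mset_image_mset)

lemma number_grid:
  assumes "finite A" "finite B"
  shows "number P (grid A B) = (\<Sum>i\<in>A. card {e \<in> complete_edges B. P (Pair i ` e)}) +
    (\<Sum>j\<in>B. card {e \<in> complete_edges A. P ((\<lambda>i. (i, j)) ` e)})"
  using assms by (simp add: grid_def number_sum number_image_complete)

lemma card_complete_edges: "finite A \<Longrightarrow> card (complete_edges A) = card A choose 2"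
  by (simp add: complete_edges_eq n_subsets)

lemma card_complete_edges_incident:
  assumes "finite A" "v \<in> A"
  shows "card {e \<in> complete_edges A. v \<in> e} = card A - 1"
proof -
  have "{e \<in> complete_edges A. v \<in> e} = (\<lambda>w. {v, w}) ` (A - {v})"
    using assms(2) by (auto simp: complete_edges_def)
  moreover have "inj_on (\<lambda>w. {v, w}) (A - {v})"
    by (auto simp: inj_on_def doubleton_eq_iff)
  ultimately show ?thesis using assms by (simp add: card_image)
qed

lemma C4_decomposable_size: "C4_decomposable M \<Longrightarrow> 4 dvd size M"
  by (induction rule: C4_decomposable.induct) (simp_all, presburger)

text \<open>A 4-cycle has no edge or two edges at any given vertex.\<close>

lemma C4_decomposable_degree: "C4_decomposable M \<Longrightarrow> even (number (\<lambda>e. v \<in> e) M)"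
  by (induction rule: C4_decomposable.induct) auto

section \<open>Row edges in the 4-cycles of a grid\<close>

definition row_edge :: "(nat \<times> nat) set \<Rightarrow> bool" where
  "row_edge e \<longleftrightarrow> (\<exists>i. \<forall>u\<in>e. fst u = i)"

definition row_0_edge :: "(nat \<times> nat) set \<Rightarrow> bool" where
  "row_0_edge e \<longleftrightarrow> (\<forall>u\<in>e. fst u = 0)"

lemma row_edge_doubleton [simp]: "row_edge {u, v} \<longleftrightarrow> fst u = fst v"
  by (auto simp: row_edge_def)

lemma row_0_edge_doubleton [simp]: "row_0_edge {u, v} \<longleftrightarrow> fst u = 0 \<and> fst v = 0"
  by (auto simp: row_0_edge_def)

lemma grid_edgesD:
  "{u, v} \<in> grid_edges m n \<Longrightarrow> u \<in> {..<m} \<times> {..<n} \<and> v \<in> {..<m} \<times> {..<n} \<and>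
     (fst u = fst v \<and> snd u \<noteq> snd v \<or> fst u \<noteq> fst v \<and> snd u = snd v)"
  by (cases u; cases v) (auto simp: grid_edges_def doubleton_eq_iff)

text \<open>Exactly one coordinate changes along each edge. Three edges of one kind force the fourth
  to be of that kind, and two consecutive row edges followed by two column edges would identify
  opposite vertices. A cycle of one kind has four distinct entries in a single coordinate, whence
  the bounds on \<open>n\<close> and \<open>m\<close>.\<close>

lemma grid_cycle_cases [consumes 5, case_names row column rectangle rectangle']:
  assumes "distinct [a, b, c, d]"
    and edges: "{a, b} \<in> grid_edges m n" "{b, c} \<in> grid_edges m n"
      "{c, d} \<in> grid_edges m n" "{d, a} \<in> grid_edges m n"
  obtains (row) "fst a = fst b" "fst b = fst c" "fst c = fst d" "n \<ge> 4"
  | (column) "fst a \<noteq> fst b" "fst b \<noteq> fst c" "fst c \<noteq> fst d" "fst d \<noteq> fst a" "m \<ge> 4"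
  | (rectangle) "fst a = fst b" "fst b \<noteq> fst c" "fst c = fst d" "fst d \<noteq> fst a"
  | (rectangle') "fst a \<noteq> fst b" "fst b = fst c" "fst c \<noteq> fst d" "fst d = fst a"
proof -
  have four: "p \<ge> 4" if "distinct [f a, f b, f c, f d]" "set [f a, f b, f c, f d] \<subseteq> {..<p}"
    for f :: "nat \<times> nat \<Rightarrow> nat" and p
  proof -
    have "card (set [f a, f b, f c, f d]) \<le> card {..<p}"
      using that(2) by (intro card_mono) auto
    then show ?thesis unfolding distinct_card[OF that(1)] by simp
  qed
  note D = edges[THEN grid_edgesD]
  then have adjacent: "snd a = snd b \<longleftrightarrow> fst a \<noteq> fst b" "snd b = snd c \<longleftrightarrow> fst b \<noteq> fst c"
    "snd c = snd d \<longleftrightarrow> fst c \<noteq> fst d" "snd d = snd a \<longleftrightarrow> fst d \<noteq> fst a"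
    by blast+
  have opposite: "fst a \<noteq> fst c \<or> snd a \<noteq> snd c" "fst b \<noteq> fst d \<or> snd b \<noteq> snd d"
    using assms(1) by (simp_all add: prod_eq_iff)
  show ?thesis
  proof (cases "fst a = fst b"; cases "fst b = fst c"; cases "fst c = fst d"; cases "fst d = fst a")
    assume *: "fst a = fst b" "fst b = fst c" "fst c = fst d" "fst d = fst a"
    then have "distinct [snd a, snd b, snd c, snd d]"
      using assms(1) by (auto simp: prod_eq_iff)
    moreover have "set [snd a, snd b, snd c, snd d] \<subseteq> {..<n}" using D by auto
    ultimately have "n \<ge> 4" by (rule four)
    then show ?thesis using * row by blast
  next
    assume *: "fst a \<noteq> fst b" "fst b \<noteq> fst c" "fst c \<noteq> fst d" "fst d \<noteq> fst a"
    then have "distinct [fst a, fst b, fst c, fst d]"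
      using assms(1) D by (auto simp: prod_eq_iff)
    moreover have "set [fst a, fst b, fst c, fst d] \<subseteq> {..<m}" using D by auto
    ultimately have "m \<ge> 4" by (rule four)
    then show ?thesis using * column by blast
  qed (use adjacent opposite rectangle rectangle' in metis)+
qed

lemma C4_decomposable_grid_rows:
  assumes "C4_decomposable M" "set_mset M \<subseteq> grid_edges m n"
  shows "even (number row_edge M)"
  using assms
proof induction
  case (add M a b c d)
  have "{a, b} \<in> grid_edges m n" "{b, c} \<in> grid_edges m n" "{c, d} \<in> grid_edges m n" "{d,
      a} \<in> grid_edges m n"
    using add.prems by auto
  from grid_cycle_cases[OF add.hyps(2) this] show ?case
    using add by cases auto
qed simp

text \<open>\<open>t\<close> counts the cycles inside row 0. Such a cycle adds 8 to the left side
  and exists only for \<open>n\<close> at least 4; a rectangle adds 2 to both sides, having one edge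
  in row 0 and two column edges; a cycle in row 1 adds nothing. Cycles inside a column would need
  four rows.\<close>

lemma C4_decomposable_two_rows:
  assumes "C4_decomposable M" "set_mset M \<subseteq> grid_edges 2 n"
  shows "\<exists>t. 2 * number row_0_edge M = number (\<lambda>e. \<not> row_edge e) M + 8 * t \<and> (n < 4 \<longrightarrow> t = 0)"
  using assms
proof induction
  case (add M a b c d)
  have e: "{a, b} \<in> grid_edges 2 n" "{b, c} \<in> grid_edges 2 n" "{c, d} \<in> grid_edges 2 n" "{d,
      a} \<in> grid_edges 2 n"
    using add.prems by auto
  have "fst u < 2" if "{u, v} \<in> grid_edges 2 n" for u v
    using grid_edgesD[OF that] by auto
  note two = e[THEN this]
  from add obtain t where t: "2 * number row_0_edge M = number (\<lambda>e. \<not> row_edge e) M + 8 * t"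
      "n < 4 \<longrightarrow> t = 0"
    by auto
  from add.hyps(2) e show ?case
  proof (cases rule: grid_cycle_cases)
    case row
    show ?thesis
    proof (cases "fst a = 0")
      case True
      then show ?thesis using t row by (intro exI[of _ "Suc t"]) auto
    next
      case False
      then show ?thesis using t row by (intro exI[of _ t]) auto
    qed
  next
    case column
    then show ?thesis by simp
  next
    case rectangle
    then have "fst a = 0 \<and> fst c = 1 \<or> fst a = 1 \<and> fst c = 0" using two by linarith
    then show ?thesis using t rectangle by (intro exI[of _ t]) auto
  next
    case rectangle'
    then have "fst a = 0 \<and> fst c = 1 \<or> fst a = 1 \<and> fst c = 0" using two by linarith
    then show ?thesis using t rectangle' by (intro exI[of _ t]) auto
  qed
qed simp

lemma complete_edgesD: "e \<in> complete_edges A \<Longrightarrow> \<exists>a b. e = {a, b} \<and> a \<in> A \<and> b \<in> A \<and> a \<noteq> b"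
  by (auto simp: complete_edges_def)

lemma not_row_edge_column:
  assumes "e \<in> complete_edges A"
  shows "\<not> row_edge ((\<lambda>i. (i, j)) ` e)"
  using complete_edgesD[OF assms] by auto

section \<open>Edge counts of the grid\<close>

lemma number_row_edge_grid:
  "number row_edge (grid {..<m} {..<n}) = m * (n choose 2)"
proof -
  have "{e \<in> complete_edges {..<n}. row_edge (Pair i ` e)} = complete_edges {..<n}" for i :: nat
    by (auto simp: row_edge_def)
  moreover have "{e \<in> complete_edges {..<m}. row_edge ((\<lambda>i. (i, j)) ` e)} = {}" for j :: nat
    by (auto simp: not_row_edge_column)
  ultimately show ?thesis by (simp add: number_grid card_complete_edges)
qed

lemma number_column_edge_grid:
  "number (\<lambda>e. \<not> row_edge e) (grid {..<m} {..<n}) = n * (m choose 2)"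
proof -
  have "{e \<in> complete_edges {..<n}. \<not> row_edge (Pair i ` e)} = {}" for i :: nat
    by (auto simp: row_edge_def)
  moreover have "{e \<in> complete_edges {..<m}. \<not> row_edge ((\<lambda>i. (i, j)) ` e)} = complete_edges {..<m}"
      for j :: nat
    by (auto simp: not_row_edge_column)
  ultimately show ?thesis by (simp add: number_grid card_complete_edges)
qed

lemma number_row_0_edge_grid:
  assumes "m > 0"
  shows "number row_0_edge (grid {..<m} {..<n}) = n choose 2"
proof -
  have "{e \<in> complete_edges {..<n}. row_0_edge (Pair i ` e)} = (if i =
      0 then complete_edges {..<n} else {})" for i :: nat
    by (auto simp: row_0_edge_def dest!: complete_edgesD)
  then have "card {e \<in> complete_edges {..<n}. row_0_edge (Pair i ` e)} = (if i =
      0 then n choose 2 else 0)" for i :: nat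
    by (simp add: card_complete_edges)
  moreover have "{e \<in> complete_edges {..<m}. row_0_edge ((\<lambda>i. (i, j)) ` e)} = {}" for j :: nat
    by (auto dest!: complete_edgesD)
  ultimately show ?thesis using assms by (simp add: number_grid sum.delta)
qed

lemma number_incident_grid:
  assumes "m > 0" "n > 0"
  shows "number (\<lambda>e. (0, 0) \<in> e) (grid {..<m} {..<n}) = m + n - 2"
proof -
  have "{e \<in> complete_edges {..<n}. (0, 0) \<in> Pair i ` e} = (if i =
      0 then {e \<in> complete_edges {..<n}. 0 \<in> e} else {})" for i :: nat
    by auto
  then have "card {e \<in> complete_edges {..<n}. (0, 0) \<in> Pair i ` e} = (if i = 0 then n - 1 else 0)"
      for i :: nat
    using assms by (simp add: card_complete_edges_incident)
  moreover have "{e \<in> complete_edges {..<m}. (0, 0) \<in> (\<lambda>i. (i, j)) ` e} = (if j =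
      0 then {e \<in> complete_edges {..<m}. 0 \<in> e} else {})" for j :: nat
    by auto
  then have "card {e \<in> complete_edges {..<m}. (0, 0) \<in> (\<lambda>i. (i, j)) ` e} = (if j =
      0 then m - 1 else 0)" for j :: nat
    using assms by (simp add: card_complete_edges_incident)
  ultimately show ?thesis using assms by (simp add: number_grid sum.delta)
qed

lemma size_grid: "size (grid {..<m} {..<n}) = m * (n choose 2) + n * (m choose 2)"
  using number_row_edge_grid[of m n] number_column_edge_grid[of m n]
  by (metis multiset_partition size_union)

lemma double_choose_2: "2 * (n choose 2) = n * (n - 1)"
proof -
  have "even (n * (n - 1))" by auto
  then show ?thesis by (simp add: choose_two)
qed

section \<open>The necessary conditions\<close>

lemma grid_decomposable_degree:
  assumes "fold_decomposable k (grid {..<m} {..<n})" "m > 0" "n > 0"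
  shows "even (k * (m + n - 2))"
  using C4_decomposable_degree[OF assms(1)[unfolded fold_decomposable_def], of "(0, 0)"] assms(2,3)
  by (simp only: number_repeat number_incident_grid)

text \<open>The grid has half of \<open>m * n * (m + n - 2)\<close> edges; doubling turns
  divisibility by 4 into divisibility by 8 and avoids the division in
  \<open>n choose 2\<close>.\<close>

lemma grid_decomposable_size:
  assumes "fold_decomposable k (grid {..<m} {..<n})" "m > 0" "n > 0"
  shows "8 dvd k * m * n * (m + n - 2)"
proof -
  have "4 dvd k * (m * (n choose 2) + n * (m choose 2))"
    using C4_decomposable_size[OF assms(1)[unfolded fold_decomposable_def]]
    by (simp add: size_grid)
  then have "2 * 4 dvd 2 * (k * (m * (n choose 2) + n * (m choose 2)))"
    by (rule mult_dvd_mono[OF dvd_refl])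
  also have "2 * (k * (m * (n choose 2) + n * (m choose 2))) =
      k * (m * (2 * (n choose 2)) + n * (2 * (m choose 2)))"
    by (simp add: algebra_simps)
  also have "\<dots> = k * m * n * ((n - 1) + (m - 1))"
    by (simp only: double_choose_2) (simp only: algebra_simps)
  also have "(n - 1) + (m - 1) = m + n - 2" using assms by simp
  finally show ?thesis by simp
qed

lemma set_mset_repeat_grid: "set_mset (repeat_mset k (grid {..<m} {..<n})) \<subseteq> grid_edges m n"
  by (induction k) (simp_all add: grid_eq_mset_set finite_grid_edges)

lemma grid_decomposable_rows:
  assumes "fold_decomposable k (grid {..<m} {..<n})"
  shows "even (k * (m * (n choose 2)))"
  using C4_decomposable_grid_rows[OF assms[unfolded fold_decomposable_def] set_mset_repeat_grid]
  by (simp only: number_repeat number_row_edge_grid)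

text \<open>For \<open>n = 4 * q + 3\<close> the number \<open>n choose 2\<close> is a product of
  two odd factors, so the even number of row edges is \<open>k\<close> times an odd number.\<close>

lemma grid_decomposable_3_3_imp_even:
  fixes m n :: nat
  assumes "fold_decomposable k (grid {..<m} {..<n})" "m mod 4 = 3" "n mod 4 = 3"
  shows "even k"
proof -
  obtain q where q: "n = 4 * q + 3" using assms(3) by (metis mult_div_mod_eq)
  have "2 * (n choose 2) = 2 * ((4 * q + 3) * (2 * q + 1))"
    unfolding double_choose_2 by (simp add: q algebra_simps)
  then have "n choose 2 = (4 * q + 3) * (2 * q + 1)" by simp
  then have "odd (n choose 2)" by simp
  moreover have "odd m" using assms(2) by presburger
  ultimately show ?thesis using grid_decomposable_rows[OF assms(1)] by simp
qed

lemma grid_decomposable_two_rows: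
  fixes n :: nat
  assumes "fold_decomposable k (grid {..<2::nat} {..<n})" "odd n" "n > 1" "k > 0"
  shows "n \<ge> 5 \<and> 8 dvd k"
proof -
  obtain t where t: "2 * (k * (n choose 2)) = k * (n * (2 choose 2)) + 8 * t" "n < 4 \<longrightarrow> t = 0"
    using C4_decomposable_two_rows[OF assms(1)[unfolded fold_decomposable_def] set_mset_repeat_grid]
    by (auto simp: number_repeat number_row_0_edge_grid number_column_edge_grid)
  obtain q where q: "n = q + 2" using assms(3) by (metis Suc_1 Suc_leI le_add_diff_inverse2)
  have "k * (2 * (n choose 2)) = k * n + 8 * t" using t(1) by (simp add: ac_simps)
  \<comment> \<open>Cancelling \<open>k * n\<close> from
    \<open>k * n * (n - 1) = k * n + 8 * t\<close> leaves the factor \<open>q = n - 2\<close>, which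
    is odd like \<open>n\<close>. For \<open>n = 3\<close> the right side is 0 and the left side is
    \<open>3 * k\<close>.\<close>
  then have *: "k * (n * q) = 8 * t"
    unfolding double_choose_2 by (simp add: q algebra_simps)
  then have "8 dvd k * (n * q)" by simp
  then have "2 ^ 3 dvd k * (n * q)" by simp
  then have "2 ^ 3 dvd k" by (rule dvd_mult_odd_cancel) (use assms(2) q in simp)
  then have "8 dvd k" by simp
  moreover have "n \<noteq> 3" using * t(2) q assms(4) by auto
  then have "n \<ge> 5" using assms(2,3) by presburger
  ultimately show ?thesis by blast
qed

lemma grid_decomposable_iff:
  assumes "m > 0" "n > 0" "k > 0" "m * n \<ge> 4"
  shows "grid_decomposable k m n \<longleftrightarrow>
    2 dvd k * (m + n - 2) \<and> 8 dvd k * m * n * (m + n - 2) \<and>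
    (m mod 8 = 3 \<and> n mod 8 = 7 \<or> n mod 8 = 3 \<and> m mod 8 = 7 \<longrightarrow> even k) \<and>
    (m = 2 \<and> odd n \<longrightarrow> n \<ge> 5 \<and> 8 dvd k) \<and> (n = 2 \<and> odd m \<longrightarrow> m \<ge> 5 \<and> 8 dvd k)"
    (is "_ \<longleftrightarrow> ?conditions")
proof
  assume *: "grid_decomposable k m n"
  have "even k" if "m mod 8 = 3 \<and> n mod 8 = 7 \<or> n mod 8 = 3 \<and> m mod 8 = 7"
  proof -
    have "m mod 4 = 3" "n mod 4 = 3" using that by presburger+
    then show ?thesis by (rule grid_decomposable_3_3_imp_even[OF *])
  qed
  moreover have "n \<ge> 5 \<and> 8 dvd k" if "m = 2 \<and> odd n"
    using that * assms by (intro grid_decomposable_two_rows) auto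
  moreover have "m \<ge> 5 \<and> 8 dvd k" if "n = 2 \<and> odd m"
    using that grid_decomposable_swap[OF *] assms by (intro grid_decomposable_two_rows) auto
  ultimately show ?conditions
    using grid_decomposable_degree[OF * assms(1,2)] grid_decomposable_size[OF * assms(1,2)] by blast
next
  assume c: ?conditions
  consider "even m" "even n" | "even m" "odd n" | "odd m" "even n" | "odd m" "odd n" by blast
  then show "grid_decomposable k m n"
  proof cases
    case 1
    then show ?thesis using fold_decomposable_dvd[OF grid_decomposable_even] by simp
  next
    case 2
    then show ?thesis using c assms by (intro grid_decomposable_even_odd) auto
  next
    case 3
    have "2 dvd k * (n + m - 2)" "8 dvd k * n * m * (n + m - 2)" "n * m \<ge> 4"
      using c assms(4) by (simp_all add: ac_simps)
    then have "grid_decomposable k n m"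
      using c assms 3 by (intro grid_decomposable_even_odd) auto
    then show ?thesis by (rule grid_decomposable_swap)
  next
    case 4
    then show ?thesis using c assms by (intro grid_decomposable_odd) auto
  qed
qed

theorem theorem1p1:
  fixes m n lam :: nat
  assumes "m > 0" and "n > 0" and "lam > 0" and "m * n \<ge> 4"
  shows "has_C4_decomposition (lambda_fold lam (line_graph (complete_bipartite m n))) \<longleftrightarrow>
    2 dvd lam * (m + n - 2) \<and>
    8 dvd lam * m * n * (m + n - 2) \<and>
    ([m = 3] (mod 8) \<and> [n = 7] (mod 8) \<or> [n = 3] (mod 8) \<and> [m = 7] (mod 8)
       \<longrightarrow> [lam = 0] (mod 2)) \<and>
    (m = 2 \<and> [n = 1] (mod 2) \<longrightarrow> n \<ge> 5 \<and> [lam = 0] (mod 8)) \<and>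
    (n = 2 \<and> [m = 1] (mod 2) \<longrightarrow> m \<ge> 5 \<and> [lam = 0] (mod 8))"
proof -
  have cong: "[q = 3] (mod 8) \<longleftrightarrow> q mod 8 = 3" "[q = 7] (mod 8) \<longleftrightarrow> q mod 8 = 7"
    "[q = 0] (mod 2) \<longleftrightarrow> even q" "[q = 1] (mod 2) \<longleftrightarrow> odd q" "[q = 0] (mod 8) \<longleftrightarrow> 8 dvd q" for q :: nat
    by (auto simp: cong_def odd_iff_mod_2_eq_one)
  show ?thesis
    unfolding has_C4_decomposition_grid grid_decomposable_iff[OF assms] cong ..
qed

end
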